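(* Let $K$ be a finite simplicial complex with vertex set $V$, $|V|=n$, let $f\colon V\to\{1,\dots,n\}$ be an order function (a bijection), and let $F_f$ be the colex vector field induced by $f$. Let $\sigma_1,\dots,\sigma_N$ be all simplices of $K$ in colex order with respect to $f$, $K^i=\{\sigma_j\mid j\le i\}$, and let $\tilde{\mathcal{K}}=\{\emptyset=K^0\subset K^1\subset\dots\subset K^N=K\}$ be the simplex-wise lower star filtration. Let $T=\{i\in\{1,\dots,N-1\}\mid\{\sigma_i\to\sigma_{i+1}\}\in F_f\}$, $J=\{1,\dots,N\}\setminus T=\{j_1<\dots<j_{N-|T|}\}$, and $$\mathcal{K}'=\{\emptyset=K^0\subset K^{j_1}\subset\dots\subset K^{j_{N-|T|}}=K\}.$$ Then the interval decomposition of $\mathsf{H}_*(\tilde{\mathcal{K}})$ is exactly composed of the intervals of the decomposition of $\mathsf{H}_*(\mathcal{K}')$ combined with $\{\mathbb{I}[i,i+1)\mid i\in T\}$ (union as multisets).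
   Context: Simplices are nonempty finite subsets of $V$; $K$ is closed under taking nonempty subsets. Homology is taken over the field $\mathbb{Z}/2\mathbb{Z}$. For $\sigma\in K$, $V_\sigma=\{v\in V\mid\{v\}\cup\sigma\in K\}$ and the candidate vertex is $c_f(\sigma)=\operatorname{argmin}_{v\in V_\sigma}f(v)$. The colex vector field $F_f$ is the collection of pairs (arrows) $\{\alpha\to\beta\}$ of simplices of $K$ of dimensions $p$ and $p+1$ (any $p\ge0$) such that $\beta=\{c_f(\alpha)\}\cup\alpha$ and $c_f(\alpha)\notin\alpha$. Colex order: view each simplex as the word of its vertices listed in increasing order of $f$. For distinct words $a=a_0\cdots a_k$ and $b=b_0\cdots b_\ell$, let $J_0$ be the smallest $i\in\{0,\dots,\min\{k,\ell\}\}$ with $a_{k-i}\ne b_{\ell-i}$. If it exists, $a<^{\mathrm{co}}b$ iff $f(a_{k-J_0})<f(b_{\ell-J_0})$; otherwise $a<^{\mathrm{co}}b$ iff $k<\ell$. For a filtration of $K$ whose frames are the $K^j$ with $j$ in an index set $I\subseteq\{0,\dots,N\}$ containing $0$ and $N$ ($I=\{0,\dots,N\}$ for $\tilde{\mathcal{K}}$, $I=\{0\}\cup J$ for $\mathcal{K}'$), $\mathsf{H}_*$ of the filtration denotes the persistence module $\bigoplus_p H_p(K^j;\mathbb{Z}/2\mathbb{Z})$, $j\in I$, with maps induced by inclusion. Its interval decomposition is its (unique up to reordering) decomposition into interval modules. For $b\in I$ and $d\in I\cup\{+\infty\}$ with $b<d$, $\mathbb{I}[b,d)$ denotes the interval module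 supported on $\{j\in I\mid b\le j<d\}$, with one-dimensional spaces and identity maps on its support. The theorem identifies intervals of the two filtrations by their endpoint labels $[b,d)$. *)

theory Defs
  imports
    "Jordan_Normal_Form.VS_Connect"
    "HOL-Algebra.AbelCoset"
    "HOL-Library.Z2"
    "HOL-Library.Extended_Nat"
    "HOL-Library.Multiset"
begin

section \<open>Simplicial complexes, the colex vector field and the colex order\<close>

definition simplicial_complex :: "'a set \<Rightarrow> 'a set set \<Rightarrow> bool" where
  "simplicial_complex V K \<longleftrightarrow>
     (\<forall>\<sigma>\<in>K. \<sigma> \<noteq> {} \<and> finite \<sigma> \<and> \<sigma> \<subseteq> V) \<and>
     (\<forall>\<sigma>\<in>K. \<forall>\<tau>. \<tau> \<noteq> {} \<and> \<tau> \<subseteq> \<sigma> \<longrightarrow> \<tau> \<in> K)"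

definition simplices :: "'a set set \<Rightarrow> nat \<Rightarrow> 'a set set" where
  "simplices K p = {\<sigma> \<in> K. card \<sigma> = Suc p}"

definition candidate_vertex :: "'a set \<Rightarrow> 'a set set \<Rightarrow> ('a \<Rightarrow> nat) \<Rightarrow> 'a set \<Rightarrow> 'a" where
  "candidate_vertex V K f \<sigma> = (ARG_MIN f v. v \<in> V \<and> {v} \<union> \<sigma> \<in> K)"

definition colex_vector_field ::
    "'a set \<Rightarrow> 'a set set \<Rightarrow> ('a \<Rightarrow> nat) \<Rightarrow> ('a set \<times> 'a set) set" where
  "colex_vector_field V K f =
     {(\<alpha>, \<beta>). (\<exists>p. \<alpha> \<in> simplices K p \<and> \<beta> \<in> simplices K (Suc p)) \<and>
              \<beta> = {candidate_vertex V K f \<alpha>} \<union> \<alpha> \<and> candidate_vertex V K f \<alpha> \<notin> \<alpha>}"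

text \<open>For nonempty words \<open>a = a\<^sub>0 \<dots> a\<^sub>k\<close> and \<open>b = b\<^sub>0 \<dots> b\<^sub>l\<close>.\<close>

definition colex_word_less :: "('a \<Rightarrow> nat) \<Rightarrow> 'a list \<Rightarrow> 'a list \<Rightarrow> bool" where
  "colex_word_less f a b =
     (let k = length a - 1; l = length b - 1;
          differ = (\<lambda>i. i \<le> min k l \<and> a ! (k - i) \<noteq> b ! (l - i));
          J\<^sub>0 = (LEAST i. differ i)
      in if \<exists>i. differ i then f (a ! (k - J\<^sub>0)) < f (b ! (l - J\<^sub>0)) else k < l)"

definition colex_less :: "('a \<Rightarrow> nat) \<Rightarrow> 'a set \<Rightarrow> 'a set \<Rightarrow> bool" where
  "colex_less f \<alpha> \<beta> =
     colex_word_less f (sorted_key_list_of_set f \<alpha>) (sorted_key_list_of_set f \<beta>)"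


section \<open>Quotients and direct sums of modules\<close>

text \<open>
  A \<^typ>\<open>('k, 'v) module\<close> record extends the ring record; the multiplicative fields
  are irrelevant for modules and left undefined.
\<close>

definition quotient_module :: "('k, 'v) module \<Rightarrow> 'v set \<Rightarrow> ('k, 'v set) module" where
  "quotient_module M N =
     \<lparr>carrier = a_rcosets\<^bsub>M\<^esub> N, mult = undefined, one = undefined,
      zero = N, add = (\<lambda>X Y. X <+>\<^bsub>M\<^esub> Y),
      smult = (\<lambda>a X. \<Union>x\<in>X. N +>\<^bsub>M\<^esub> (a \<odot>\<^bsub>M\<^esub> x))\<rparr>"

definition direct_sum_module :: "'i set \<Rightarrow> ('i \<Rightarrow> ('k, 'v) module) \<Rightarrow> ('k, 'i \<Rightarrow> 'v) module" where
  "direct_sum_module A M =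
     \<lparr>carrier = {x \<in> \<Pi>\<^sub>E i\<in>A. carrier (M i). finite {i \<in> A. x i \<noteq> \<zero>\<^bsub>M i\<^esub>}},
      mult = undefined, one = undefined,
      zero = (\<lambda>i\<in>A. \<zero>\<^bsub>M i\<^esub>),
      add = (\<lambda>x y. \<lambda>i\<in>A. x i \<oplus>\<^bsub>M i\<^esub> y i),
      smult = (\<lambda>a x. \<lambda>i\<in>A. a \<odot>\<^bsub>M i\<^esub> x i)\<rparr>"


section \<open>Simplicial homology over \<open>\<int>/2\<int>\<close>\<close>

text \<open>
  A \<open>p\<close>-chain of a finite complex \<open>L\<close> is a function on all sets that vanishes off the
  \<open>p\<close>-simplices of \<open>L\<close>. Hence for \<open>L \<subseteq> L'\<close> the map of chain modules induced by the
  inclusion is the identity on functions.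
\<close>

definition chain_module :: "'a set set \<Rightarrow> nat \<Rightarrow> (bit, 'a set \<Rightarrow> bit) module" where
  "chain_module L p =
     \<lparr>carrier = {c. \<forall>\<sigma>. \<sigma> \<notin> simplices L p \<longrightarrow> c \<sigma> = 0},
      mult = undefined, one = undefined,
      zero = (\<lambda>_. 0), add = (\<lambda>c d \<sigma>. c \<sigma> + d \<sigma>), smult = (\<lambda>a c \<sigma>. a * c \<sigma>)\<rparr>"

text \<open>\<open>boundary L p\<close> is the boundary map from \<open>(p + 1)\<close>-chains to \<open>p\<close>-chains.\<close>

definition boundary :: "'a set set \<Rightarrow> nat \<Rightarrow> ('a set \<Rightarrow> bit) \<Rightarrow> 'a set \<Rightarrow> bit" where
  "boundary L p c =
     (\<lambda>\<tau>. if \<tau> \<in> simplices L p then \<Sum>\<sigma> | \<sigma> \<in> simplices L (Suc p) \<and> \<tau> \<subset> \<sigma>. c \<sigma> else 0)"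

text \<open>Homology is unreduced: every \<open>0\<close>-chain is a cycle.\<close>

fun cycles :: "'a set set \<Rightarrow> nat \<Rightarrow> ('a set \<Rightarrow> bit) set" where
  "cycles L 0 = carrier (chain_module L 0)"
| "cycles L (Suc p) = {c \<in> carrier (chain_module L (Suc p)). boundary L p c = (\<lambda>_. 0)}"

definition boundaries :: "'a set set \<Rightarrow> nat \<Rightarrow> ('a set \<Rightarrow> bit) set" where
  "boundaries L p = boundary L p ` carrier (chain_module L (Suc p))"

definition homology_module :: "'a set set \<Rightarrow> nat \<Rightarrow> (bit, ('a set \<Rightarrow> bit) set) module" where
  "homology_module L p =
     quotient_module ((chain_module L p)\<lparr>carrier := cycles L p\<rparr>) (boundaries L p)"

text \<open>
  For \<open>L \<subseteq> L'\<close>, the map \<open>H\<^sub>p(L) \<rightarrow> H\<^sub>p(L')\<close> induced by the inclusion, sending the class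
  of a cycle \<open>z\<close> in \<open>L\<close> to its class in \<open>L'\<close>; it depends on the target \<open>L'\<close> only.
\<close>

definition homology_map :: "'a set set \<Rightarrow> nat \<Rightarrow> ('a set \<Rightarrow> bit) set \<Rightarrow> ('a set \<Rightarrow> bit) set" where
  "homology_map L' p X = (\<Union>z\<in>X. boundaries L' p +>\<^bsub>chain_module L' p\<^esub> z)"


section \<open>Persistence modules and interval decompositions\<close>

text \<open>
  The data of a persistence module indexed by a set of natural numbers. Only
  \<open>pspace M j\<close> with \<open>j \<in> pindex M\<close>, and \<open>pmap M i j\<close> with \<open>i \<le> j\<close> in \<open>pindex M\<close>
  on the carrier of \<open>pspace M i\<close>, are meaningful.
\<close>

record ('k, 'v) persistence_module =
  pindex :: "nat set"
  pspace :: "nat \<Rightarrow> ('k, 'v) module"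
  pmap :: "nat \<Rightarrow> nat \<Rightarrow> 'v \<Rightarrow> 'v"

definition persistence_iso ::
    "('k::field, 'v) persistence_module \<Rightarrow> ('k, 'w) persistence_module \<Rightarrow> bool" where
  "persistence_iso M N \<longleftrightarrow>
     pindex M = pindex N \<and>
     (\<exists>\<phi>. (\<forall>j\<in>pindex M. \<phi> j \<in> LinearCombinations.module_hom class_ring (pspace M j) (pspace N j) \<and>
               bij_betw (\<phi> j) (carrier (pspace M j)) (carrier (pspace N j))) \<and>
          (\<forall>i\<in>pindex M. \<forall>j\<in>pindex M. i \<le> j \<longrightarrow>
             (\<forall>x\<in>carrier (pspace M i). \<phi> j (pmap M i j x) = pmap N i j (\<phi> i x))))"

definition persistence_sum ::
    "nat set \<Rightarrow> 'i set \<Rightarrow> ('i \<Rightarrow> ('k, 'v) persistence_module) \<Rightarrow> ('k, 'i \<Rightarrow> 'v) persistence_module" where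
  "persistence_sum I A M =
     \<lparr>pindex = I,
      pspace = (\<lambda>j. direct_sum_module A (\<lambda>t. pspace (M t) j)),
      pmap = (\<lambda>i j x. \<lambda>t\<in>A. pmap (M t) i j (x t))\<rparr>"

text \<open>\<open>H\<^sub>*\<close> of the filtration with frames \<open>F j\<close>, \<open>j \<in> I\<close>.\<close>

definition filtration_homology ::
    "nat set \<Rightarrow> (nat \<Rightarrow> 'a set set) \<Rightarrow> (bit, nat \<Rightarrow> ('a set \<Rightarrow> bit) set) persistence_module" where
  "filtration_homology I F =
     persistence_sum I (UNIV :: nat set)
       (\<lambda>p. \<lparr>pindex = I,
             pspace = (\<lambda>j. homology_module (F j) p),
             pmap = (\<lambda>i j. homology_map (F j) p)\<rparr>)"

text \<open>
  The interval module on \<open>I\<close> labelled \<open>[b, d)\<close>. Over a field type \<open>'k\<close>, its spaces are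
  \<open>'k\<close> itself on the support and the zero subspace of \<open>'k\<close> elsewhere.
\<close>

definition interval_module :: "nat set \<Rightarrow> nat \<times> enat \<Rightarrow> ('k::field, 'k) persistence_module" where
  "interval_module I = (\<lambda>(b, d).
     let S = {j \<in> I. b \<le> j \<and> enat j < d} in
     \<lparr>pindex = I,
      pspace = (\<lambda>j. \<lparr>carrier = (if j \<in> S then UNIV else {0}), mult = undefined, one = undefined,
                     zero = 0, add = (+), smult = (*)\<rparr>),
      pmap = (\<lambda>i j x. if i \<in> S \<and> j \<in> S then x else 0)\<rparr>)"

definition interval_labels :: "nat set \<Rightarrow> (nat \<times> enat) set" where
  "interval_labels I = {(b, d). b \<in> I \<and> d \<in> insert \<infinity> (enat ` I) \<and> enat b < d}"

text \<open>
  A finite multiset \<open>B\<close> of labels stands for the direct sum with one summand for each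
  occurrence \<open>(x, k)\<close>, \<open>k < count B x\<close>, of a label \<open>x\<close> in \<open>B\<close>.
\<close>

definition decomposes_into :: "('k::field, 'v) persistence_module \<Rightarrow> (nat \<times> enat) multiset \<Rightarrow> bool" where
  "decomposes_into M B \<longleftrightarrow>
     set_mset B \<subseteq> interval_labels (pindex M) \<and>
     persistence_iso M
       (persistence_sum (pindex M) {(x, k :: nat). k < count B x}
          (\<lambda>(x, k). (interval_module (pindex M) x :: ('k, 'k) persistence_module)))"

text \<open>
  Such a \<open>B\<close> exists and is unique for every persistence module over a finite index set
  with finite-dimensional spaces, in particular for the homology of a filtration of a
  finite complex.
\<close>

definition interval_decomposition :: "('k::field, 'v) persistence_module \<Rightarrow> (nat \<times> enat) multiset" where
  "interval_decomposition M = (THE B. decomposes_into M B)"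

end

(*
Inserting the simplices one by one yields a basis z_1, ..., z_N of the chains, z_i with latest simplex
sigma_i, and a partial injection q such that the boundary of z_k is z_(q k), or 0 if q k is undefined.
For every subset I of the indices, the homology of the frames with index in I is then the sum of the
intervals [q k, k) and of the intervals [i, infinity) with z_i an unpaired cycle, provided the
discarded intervals do not meet I. In colex order faces come first, so for an arrow from sigma_i
to sigma_(i+1) the simplex sigma_i is the latest one in the boundary of z_(i+1); hence q (i+1) = i.
Leaving out the indices in T therefore discards exactly the intervals [i, i+1) with i in T and keeps
the endpoints of all the others. An interval decomposition is unique because the ranks of the maps
determine the multiplicities.
*)

theory Submission
  imports Defs
begin

text \<open>One basis has to serve two index sets, so no argument may refer to consecutive frames. A
  basis cycle \<open>z i\<close> contributes a basis class to frame j exactly when i \<le> j and j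
  lies before the partner of i, if there is one; this condition involves the single frame j only.
  The coordinates on the homology of a frame are thus the same whether or not its neighbours are
  kept, and thinning the index set only requires that the endpoints of the remaining intervals
  survive. They do: for i in T the equation i = q (i+1) makes \<open>z i\<close> a boundary, hence a
  cycle, so q i = 0 and i is nobody's right endpoint. A second obstacle is that the interval
  decomposition is a definite description, so uniqueness must be proved before either side of the
  equation can be computed. Over a finite field the rank of a map can be read off from the
  cardinality of its image; comparing cardinalities therefore takes the place of dimension
  theory.\<close>

section \<open>Paired bases of filtered complexes\<close>

text \<open>A graded differential whose matrix \<open>D\<close> is strictly upper triangular in the
  order of insertion. Simplices are absent, so the pairing argument is linear algebra over an
  arbitrary field; \<open>g\<close> plays the role of the dimension.\<close>

locale filtered_complex =
  fixes N :: nat and \<sigma> :: "nat \<Rightarrow> 'b" and g :: "'b \<Rightarrow> nat" and D :: "'b \<Rightarrow> 'b \<Rightarrow> 'k::field"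
  assumes inj_\<sigma>: "inj_on \<sigma> {1..N}"
    and D_earlier: "\<And>\<tau> k. k \<in> {1..N} \<Longrightarrow> D \<tau> (\<sigma> k) \<noteq> 0 \<Longrightarrow> \<tau> \<in> \<sigma> ` {1..<k} \<and> g (\<sigma> k) = Suc (g \<tau>)"
    and D_D: "\<And>\<tau> l. l \<in> {1..N} \<Longrightarrow> (\<Sum>k\<in>{1..N}. D \<tau> (\<sigma> k) * D (\<sigma> k) (\<sigma> l)) = 0"
begin

section \<open>Homogeneous chains and their boundaries\<close>

definition chain :: "nat \<Rightarrow> nat \<Rightarrow> ('b \<Rightarrow> 'k) \<Rightarrow> bool" where
  "chain m h c \<longleftrightarrow> (\<forall>\<tau>. c \<tau> \<noteq> 0 \<longrightarrow> \<tau> \<in> \<sigma> ` {1..m} \<and> g \<tau> = h)"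

text \<open>The sum runs over the whole complex and not over a frame, so a single linear map serves
  all frames and inclusions need no compatibility proof.\<close>

definition bd :: "('b \<Rightarrow> 'k) \<Rightarrow> 'b \<Rightarrow> 'k" where
  "bd c = (\<lambda>\<tau>. \<Sum>k\<in>{1..N}. D \<tau> (\<sigma> k) * c (\<sigma> k))"

lemma chain_mono: "chain m h c \<Longrightarrow> m \<le> m' \<Longrightarrow> chain m' h c"
  unfolding chain_def by fastforce

lemma chain_add: "chain m h c \<Longrightarrow> chain m h c' \<Longrightarrow> chain m h (\<lambda>\<tau>. c \<tau> + c' \<tau>)"
  unfolding chain_def by (metis add_0)

text \<open>The zero chain has every degree and every support bound, so terms with coefficient 0
  impose no condition.\<close>

lemma chain_comb:
  assumes "\<And>i. i \<in> S \<Longrightarrow> a i \<noteq> 0 \<Longrightarrow> chain m h (z i)"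
  shows "chain m h (\<lambda>\<tau>. \<Sum>i\<in>S. a i * z i \<tau>)"
  unfolding chain_def
proof (intro allI impI)
  fix \<tau> assume "(\<Sum>i\<in>S. a i * z i \<tau>) \<noteq> 0"
  then obtain i where "i \<in> S" "a i * z i \<tau> \<noteq> 0" by (meson sum.neutral)
  then show "\<tau> \<in> \<sigma> ` {1..m} \<and> g \<tau> = h" using assms[of i] unfolding chain_def by auto
qed

lemma bd_add: "bd (\<lambda>\<tau>. c \<tau> + c' \<tau>) = (\<lambda>\<tau>. bd c \<tau> + bd c' \<tau>)"
  unfolding bd_def by (simp add: distrib_left sum.distrib)

lemma bd_comb: "bd (\<lambda>\<tau>. \<Sum>i\<in>S. a i * z i \<tau>) = (\<lambda>\<tau>. \<Sum>i\<in>S. a i * bd (z i) \<tau>)"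
proof
  fix \<tau>
  have "bd (\<lambda>\<tau>. \<Sum>i\<in>S. a i * z i \<tau>) \<tau> = (\<Sum>k\<in>{1..N}. \<Sum>i\<in>S. a i * (D \<tau> (\<sigma> k) * z i (\<sigma> k)))"
    unfolding bd_def by (simp add: sum_distrib_left ac_simps)
  also have "\<dots> = (\<Sum>i\<in>S. \<Sum>k\<in>{1..N}. a i * (D \<tau> (\<sigma> k) * z i (\<sigma> k)))" by (rule sum.swap)
  finally show "bd (\<lambda>\<tau>. \<Sum>i\<in>S. a i * z i \<tau>) \<tau> = (\<Sum>i\<in>S. a i * bd (z i) \<tau>)"
    unfolding bd_def by (simp add: sum_distrib_left)
qed

lemma bd_bd: "bd (bd c) = (\<lambda>_. 0)"
proof
  fix \<tau>
  have "bd (bd c) \<tau> = (\<Sum>k\<in>{1..N}. \<Sum>l\<in>{1..N}. D \<tau> (\<sigma> k) * D (\<sigma> k) (\<sigma> l) * c (\<sigma> l))"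
    unfolding bd_def by (simp add: sum_distrib_left mult.assoc)
  also have "\<dots> = (\<Sum>l\<in>{1..N}. \<Sum>k\<in>{1..N}. D \<tau> (\<sigma> k) * D (\<sigma> k) (\<sigma> l) * c (\<sigma> l))" by (rule sum.swap)
  also have "\<dots> = (\<Sum>l\<in>{1..N}. (\<Sum>k\<in>{1..N}. D \<tau> (\<sigma> k) * D (\<sigma> k) (\<sigma> l)) * c (\<sigma> l))"
    by (simp add: sum_distrib_right)
  also have "\<dots> = 0" by (intro sum.neutral) (simp add: D_D del: One_nat_def)
  finally show "bd (bd c) \<tau> = 0" .
qed

text \<open>Every face of a simplex precedes it strictly, whence the bound m - 1. For m = 0 the
  chain is zero and truncated subtraction does no damage.\<close>

lemma bd_support:
  assumes "chain m h c" "m \<le> N" "bd c \<tau> \<noteq> 0"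
  shows "\<tau> \<in> \<sigma> ` {1..m - 1} \<and> h = Suc (g \<tau>)"
proof -
  obtain k where k: "k \<in> {1..N}" "D \<tau> (\<sigma> k) * c (\<sigma> k) \<noteq> 0"
    using assms(3) unfolding bd_def by (meson sum.neutral)
  then have nz: "D \<tau> (\<sigma> k) \<noteq> 0" "c (\<sigma> k) \<noteq> 0" by auto
  have "\<sigma> k \<in> \<sigma> ` {1..m}" "g (\<sigma> k) = h" using nz(2) assms(1) unfolding chain_def by auto
  then have "k \<le> m" using inj_\<sigma> k(1) assms(2) by (auto dest!: inj_onD)
  then have "{1..<k} \<subseteq> {1..m - 1}" by auto
  then show ?thesis using D_earlier[OF k(1) nz(1)] \<open>g (\<sigma> k) = h\<close> by blast
qed

lemma bd_chain: "chain m (Suc h) c \<Longrightarrow> m \<le> N \<Longrightarrow> chain (m - 1) h (bd c)"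
  using bd_support unfolding chain_def[of _ h] by blast

lemma bd_chain_0: "chain m 0 c \<Longrightarrow> m \<le> N \<Longrightarrow> bd c = (\<lambda>_. 0)"
  using bd_support by blast

section \<open>Triangular bases adapted to the filtration and the grading\<close>

definition triangular :: "nat \<Rightarrow> (nat \<Rightarrow> 'b \<Rightarrow> 'k) \<Rightarrow> bool" where
  "triangular m z \<longleftrightarrow> (\<forall>k\<in>{1..m}. z k (\<sigma> k) \<noteq> 0 \<and> chain k (g (\<sigma> k)) (z k))"

lemma triangular_mono: "triangular m z \<Longrightarrow> m' \<le> m \<Longrightarrow> triangular m' z"
  unfolding triangular_def by auto

text \<open>Elimination from the last simplex downwards: among the first m basis chains only
  \<open>z m\<close> is nonzero at the m-th simplex.\<close>

lemma triangular_expand: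
  assumes "m \<le> N" "triangular m z" "chain m h c"
  shows "\<exists>a. (\<forall>i. a i \<noteq> 0 \<longrightarrow> i \<in> {1..m} \<and> g (\<sigma> i) = h) \<and> c = (\<lambda>\<tau>. \<Sum>i\<in>{1..m}. a i * z i \<tau>)"
  using assms
proof (induction m arbitrary: c)
  case 0
  then have "c = (\<lambda>_. 0)" unfolding chain_def by auto
  then show ?case by (intro exI[of _ "\<lambda>_. 0"]) auto
next
  case (Suc m)
  \<comment> \<open>The multiple of the last basis chain that clears the coefficient of c at the
    last simplex, so that the remainder lives in the previous frame.\<close>
  define b where "b = c (\<sigma> (Suc m)) / z (Suc m) (\<sigma> (Suc m))"
  define c' where "c' = (\<lambda>\<tau>. c \<tau> + (- b) * z (Suc m) \<tau>)"
  have z: "z (Suc m) (\<sigma> (Suc m)) \<noteq> 0" "chain (Suc m) (g (\<sigma> (Suc m))) (z (Suc m))"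
    using Suc.prems(2) unfolding triangular_def by auto
  \<comment> \<open>If b is nonzero, the last simplex lies in the support of c, which has degree h
    throughout.\<close>
  have bh: "b \<noteq> 0 \<Longrightarrow> g (\<sigma> (Suc m)) = h" using Suc.prems(3) unfolding b_def chain_def by auto
  have "chain (Suc m) h (\<lambda>\<tau>. (- b) * z (Suc m) \<tau>)"
    using z(2) bh unfolding chain_def by (cases "b = 0") auto
  then have "chain (Suc m) h c'" unfolding c'_def by (rule chain_add[OF Suc.prems(3)])
  moreover have "c' (\<sigma> (Suc m)) = 0" unfolding c'_def b_def using z(1) by simp
  ultimately have "chain m h c'" unfolding chain_def by (force simp: le_Suc_eq)
  then obtain a where a: "\<And>i. a i \<noteq> 0 \<Longrightarrow> i \<in> {1..m} \<and> g (\<sigma> i) = h"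
    and c': "c' = (\<lambda>\<tau>. \<Sum>i\<in>{1..m}. a i * z i \<tau>)"
    using Suc.IH[of c'] Suc.prems(1) triangular_mono[OF Suc.prems(2), of m] by auto
  have "c = (\<lambda>\<tau>. \<Sum>i\<in>{1..Suc m}. (a(Suc m := b)) i * z i \<tau>)"
  proof
    fix \<tau>
    have "(\<Sum>i\<in>{1..Suc m}. (a(Suc m := b)) i * z i \<tau>) = c' \<tau> + b * z (Suc m) \<tau>"
      unfolding c' by (auto intro!: sum.cong simp: add.commute)
    then show "c \<tau> = (\<Sum>i\<in>{1..Suc m}. (a(Suc m := b)) i * z i \<tau>)"
      unfolding c'_def by simp
  qed
  moreover have "\<forall>i. (a(Suc m := b)) i \<noteq> 0 \<longrightarrow> i \<in> {1..Suc m} \<and> g (\<sigma> i) = h"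
  proof (intro allI impI)
    fix i assume "(a(Suc m := b)) i \<noteq> 0"
    then show "i \<in> {1..Suc m} \<and> g (\<sigma> i) = h" using a[of i] bh by (cases "i = Suc m") auto
  qed
  ultimately show ?case by blast
qed

text \<open>Evaluate the relation at the simplex of the largest index with nonzero coefficient:
  earlier basis chains vanish there.\<close>

lemma triangular_independent:
  assumes "m \<le> N" "triangular m z" "\<And>\<tau>. (\<Sum>i\<in>{1..m}. a i * z i \<tau>) = 0" "i \<in> {1..m}"
  shows "a i = 0"
proof (rule ccontr)
  assume "a i \<noteq> 0"
  define k where "k = Max {i \<in> {1..m}. a i \<noteq> 0}"
  have "k \<in> {i \<in> {1..m}. a i \<noteq> 0}" unfolding k_def using assms(4) \<open>a i \<noteq> 0\<close> by (intro Max_in) auto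
  then have k: "k \<in> {1..m}" "a k \<noteq> 0" by auto
  have mx: "j \<le> k" if "j \<in> {1..m}" "a j \<noteq> 0" for j
    unfolding k_def using that by (intro Max_ge) auto
  have zero: "a j * z j (\<sigma> k) = 0" if "j \<in> {1..m} - {k}" for j
  proof (cases "a j = 0")
    case False
    then have "j < k" using mx that by force
    moreover have "\<sigma> k \<notin> \<sigma> ` {1..j}" using \<open>j < k\<close> k(1) assms(1) inj_\<sigma> by (auto dest!: inj_onD)
    ultimately show ?thesis using assms(2) that unfolding triangular_def chain_def by fastforce
  qed simp
  have "(\<Sum>i\<in>{1..m}. a i * z i (\<sigma> k)) = a k * z k (\<sigma> k)"
    using k(1) zero by (subst sum.remove[of _ k]) (simp_all add: sum.neutral del: One_nat_def)
  then show False using assms(2,3) k unfolding triangular_def by auto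
qed

text \<open>
  A basis in which the boundary of \<open>z k\<close> is \<open>z (q k)\<close>; the convention \<open>z 0 = 0\<close> encodes
  cycles by \<open>q k = 0\<close>.
\<close>

definition paired_basis :: "nat \<Rightarrow> (nat \<Rightarrow> 'b \<Rightarrow> 'k) \<Rightarrow> (nat \<Rightarrow> nat) \<Rightarrow> bool" where
  "paired_basis m z q \<longleftrightarrow> triangular m z \<and> z 0 = (\<lambda>_. 0) \<and>
     (\<forall>k\<in>{1..m}. q k < k \<and> bd (z k) = z (q k) \<and> (q k \<noteq> 0 \<longrightarrow> g (\<sigma> k) = Suc (g (\<sigma> (q k))))) \<and>
     inj_on q {k \<in> {1..m}. q k \<noteq> 0}"

text \<open>Terms with q k = 0 drop out because \<open>z 0\<close> is zero, and q is injective on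
  the others. Intersecting with {1..m} removes the conventional value 0 from the image of q.\<close>

lemma paired_comb_reindex:
  assumes "paired_basis m z q"
  shows "(\<Sum>k\<in>{1..m}. a (q k) * z (q k) \<tau>) = (\<Sum>i\<in>{1..m} \<inter> q ` {1..m}. a i * z i \<tau>)"
proof -
  have z0: "z 0 = (\<lambda>_. 0)" and q: "inj_on q {k \<in> {1..m}. q k \<noteq> 0}" "\<And>k. k \<in> {1..m} \<Longrightarrow> q k < k"
    using assms unfolding paired_basis_def by auto
  have "(\<Sum>k\<in>{1..m}. a (q k) * z (q k) \<tau>) = (\<Sum>k\<in>{k \<in> {1..m}. q k \<noteq> 0}. a (q k) * z (q k) \<tau>)"
    by (intro sum.mono_neutral_right) (auto simp: z0)
  also have "\<dots> = (\<Sum>i\<in>q ` {k \<in> {1..m}. q k \<noteq> 0}. a i * z i \<tau>)"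
    by (simp only: sum.reindex[OF q(1)] o_def)
  also have "q ` {k \<in> {1..m}. q k \<noteq> 0} = {1..m} \<inter> q ` {1..m}" using q(2) by force
  finally show ?thesis .
qed

text \<open>The boundary map sends the basis chains that are not cycles to distinct basis chains, so
  no nontrivial combination of their boundaries can cancel.\<close>

lemma paired_basis_cycle_coeffs:
  assumes m: "m \<le> N" and B: "paired_basis m z q"
    and cyc: "bd (\<lambda>\<tau>. \<Sum>i\<in>{1..m}. a i * z i \<tau>) = (\<lambda>_. 0)"
    and i: "i \<in> {1..m}" "q i \<noteq> 0"
  shows "a i = 0"
proof -
  have tri: "triangular m z" and z0: "z 0 = (\<lambda>_. 0)"
    and q: "inj_on q {k \<in> {1..m}. q k \<noteq> 0}" "\<And>k. k \<in> {1..m} \<Longrightarrow> q k < k"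
    and bd: "\<And>k. k \<in> {1..m} \<Longrightarrow> bd (z k) = z (q k)"
    using B unfolding paired_basis_def by auto
  define Q where "Q = {k \<in> {1..m}. q k \<noteq> 0}"
  \<comment> \<open>The coefficients of the boundary of the combination: q carries the coefficient
    of \<open>z k\<close> to \<open>z (q k)\<close>.\<close>
  define b where "b l = (if l \<in> q ` Q then a (the_inv_into Q q l) else 0)" for l
  have b: "b (q k) = a k" if "k \<in> Q" for k
    unfolding b_def using that q(1) by (simp add: the_inv_into_f_f Q_def)
  have "(\<Sum>l\<in>{1..m}. b l * z l \<tau>) = 0" for \<tau>
  proof -
    have "q ` Q \<subseteq> {1..m}" unfolding Q_def using q(2) by force
    then have "(\<Sum>l\<in>{1..m}. b l * z l \<tau>) = (\<Sum>l\<in>q ` Q. b l * z l \<tau>)"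
      by (intro sum.mono_neutral_right) (auto simp: b_def)
    also have "\<dots> = (\<Sum>k\<in>Q. a k * z (q k) \<tau>)"
      using q(1) b by (simp add: sum.reindex Q_def)
    also have "\<dots> = (\<Sum>k\<in>{1..m}. a k * z (q k) \<tau>)"
      by (intro sum.mono_neutral_left) (auto simp: Q_def z0)
    also have "\<dots> = (\<Sum>k\<in>{1..m}. a k * bd (z k) \<tau>)" using bd by simp
    also have "\<dots> = 0" using cyc unfolding bd_comb by meson
    finally show ?thesis .
  qed
  moreover have "q i \<in> {1..m}" using i q(2)[of i] by auto
  ultimately have "b (q i) = 0" by (rule triangular_independent[OF m tri])
  then show ?thesis using b i unfolding Q_def by auto
qed

text \<open>Otherwise the double boundary of \<open>z k\<close> would be a basis chain, which is
  nonzero on the diagonal.\<close>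

lemma paired_basis_cycle:
  assumes "m \<le> N" "paired_basis m z q" "k \<in> {1..m}" "q k \<noteq> 0"
  shows "q (q k) = 0"
proof (rule ccontr)
  assume nz: "q (q k) \<noteq> 0"
  have "q k < k" using assms unfolding paired_basis_def by auto
  then have qk: "q k \<in> {1..m}" using assms(3,4) by auto
  have "bd (z k) = z (q k)" "bd (z (q k)) = z (q (q k))"
    using assms qk unfolding paired_basis_def by auto
  then have "z (q (q k)) = (\<lambda>_. 0)" using bd_bd by metis
  moreover have "q (q k) < q k" using qk assms unfolding paired_basis_def by auto
  then have "q (q k) \<in> {1..m}" using qk nz by auto
  ultimately show False using assms(2) unfolding paired_basis_def triangular_def by metis
qed

text \<open>Each induction step is one column of the reduction of the boundary matrix used to
  compute persistent homology.\<close>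

lemma paired_basis_exists:
  assumes "m \<le> N"
  shows "\<exists>z q. paired_basis m z q"
  using assms
proof (induction m)
  case 0
  show ?case by (intro exI[of _ "\<lambda>_ _. 0"] exI[of _ id]) (auto simp: paired_basis_def triangular_def)
next
  case (Suc m)
  then obtain z q where B: "paired_basis m z q" by auto
  have m: "m \<le> N" using Suc.prems by simp
  have tri: "triangular m z" and z0: "z 0 = (\<lambda>_. 0)"
    and q: "inj_on q {k \<in> {1..m}. q k \<noteq> 0}" "\<And>k. k \<in> {1..m} \<Longrightarrow> q k < k"
    and bd: "\<And>k. k \<in> {1..m} \<Longrightarrow> bd (z k) = z (q k)"
    and gq: "\<And>k. k \<in> {1..m} \<Longrightarrow> q k \<noteq> 0 \<Longrightarrow> g (\<sigma> k) = Suc (g (\<sigma> (q k)))"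
    using B unfolding paired_basis_def by auto
  have zk: "z k (\<sigma> k) \<noteq> 0" "chain k (g (\<sigma> k)) (z k)" if "k \<in> {1..m}" for k
    using tri that unfolding triangular_def by auto
  define G where "G = g (\<sigma> (Suc m))"
  define e where "e = (\<lambda>\<tau>. if \<tau> = \<sigma> (Suc m) then (1::'k) else 0)"
  have e: "chain (Suc m) G e" unfolding chain_def e_def G_def by auto
  txt \<open>Expand the boundary of the new simplex \<open>e\<close> in the old basis. Coefficients at \<open>z (q k)\<close> are
    removed by adding multiples of \<open>z k\<close> to \<open>e\<close>. What remains of the boundary is a cycle \<open>y\<close>
    supported on unpaired cycles, which replaces the latest of them.\<close>
  have "\<exists>a. (\<forall>i. a i \<noteq> 0 \<longrightarrow> i \<in> {1..m} \<and> G = Suc (g (\<sigma> i))) \<and> bd e = (\<lambda>\<tau>. \<Sum>i\<in>{1..m}. a i * z i \<tau>)"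
  proof (cases G)
    case 0
    then show ?thesis using bd_chain_0[of "Suc m" e] e Suc.prems by (intro exI[of _ "\<lambda>_. 0"]) auto
  next
    case (Suc h)
    then have "chain m h (bd e)" using bd_chain[of "Suc m" h e] e Suc.prems by auto
    from triangular_expand[OF m tri this] show ?thesis using Suc by auto
  qed
  then obtain a where a: "\<And>i. a i \<noteq> 0 \<Longrightarrow> i \<in> {1..m} \<and> G = Suc (g (\<sigma> i))"
    and bde: "bd e = (\<lambda>\<tau>. \<Sum>i\<in>{1..m}. a i * z i \<tau>)" by auto
  have "bd (\<lambda>\<tau>. \<Sum>i\<in>{1..m}. a i * z i \<tau>) = (\<lambda>_. 0)" using bd_bd[of e] unfolding bde .
  \<comment> \<open>The boundary of \<open>e\<close> is itself a cycle, so only basis cycles occur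
    in its expansion.\<close>
  then have aq: "a i = 0" if "q i \<noteq> 0" for i
    using paired_basis_cycle_coeffs[OF m B] that a by blast
  define w where "w = (\<lambda>\<tau>. e \<tau> + (\<Sum>k\<in>{1..m}. (- a (q k)) * z k \<tau>))"
  define y where "y = (\<lambda>\<tau>. \<Sum>i\<in>{1..m} - q ` {1..m}. a i * z i \<tau>)"
  have bdw: "bd w = y"
  proof
    fix \<tau>
    have "bd w \<tau> = (\<Sum>i\<in>{1..m}. a i * z i \<tau>) - (\<Sum>k\<in>{1..m}. a (q k) * z (q k) \<tau>)"
      unfolding w_def bd_add bd_comb bde using bd by (simp add: sum_negf)
    also have "\<dots> = (\<Sum>i\<in>{1..m}. a i * z i \<tau>) - (\<Sum>i\<in>{1..m} \<inter> q ` {1..m}. a i * z i \<tau>)"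
      by (simp only: paired_comb_reindex[OF B])
    also have "(\<Sum>i\<in>{1..m}. a i * z i \<tau>) = y \<tau> + (\<Sum>i\<in>{1..m} \<inter> q ` {1..m}. a i * z i \<tau>)"
      unfolding y_def by (subst sum.Int_Diff[of _ _ "q ` {1..m}"]) (auto simp: add.commute)
    finally show "bd w \<tau> = y \<tau>" by simp
  qed
  have w1: "chain (Suc m) G w" unfolding w_def
  proof (rule chain_add[OF e], rule chain_comb)
    fix k assume k: "k \<in> {1..m}" "- a (q k) \<noteq> 0"
    then have "q k \<in> {1..m}" "G = Suc (g (\<sigma> (q k)))" using a by auto
    then have "G = g (\<sigma> k)" using gq[OF k(1)] by auto
    then show "chain (Suc m) G (z k)" using zk(2)[OF k(1)] k(1) by (auto intro: chain_mono)
  qed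
  have new: "\<sigma> (Suc m) \<notin> \<sigma> ` {1..m}" using inj_\<sigma> Suc.prems by (force dest: inj_onD)
  have w2: "w (\<sigma> (Suc m)) = 1"
  proof -
    have "z k (\<sigma> (Suc m)) = 0" if "k \<in> {1..m}" for k
      using zk(2)[OF that] new that unfolding chain_def by fastforce
    then show ?thesis unfolding w_def e_def by (simp add: sum.neutral)
  qed
  show ?case
  proof (cases "\<forall>i\<in>{1..m} - q ` {1..m}. a i = 0")
    case True
    then have y0: "y = (\<lambda>_. 0)" unfolding y_def by (auto intro!: sum.neutral)
    \<comment> \<open>The corrected chain \<open>w\<close> is a cycle: the new simplex creates a
      class and destroys none.\<close>
    have "paired_basis (Suc m) (z(Suc m := w)) (q(Suc m := 0))"
      unfolding paired_basis_def triangular_def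
    proof (intro conjI ballI)
      show "inj_on (q(Suc m := 0)) {k \<in> {1..Suc m}. (q(Suc m := 0)) k \<noteq> 0}"
        using q(1) by (auto simp: inj_on_def le_Suc_eq)
    next
      fix k assume k: "k \<in> {1..Suc m}"
      show "bd ((z(Suc m := w)) k) = (z(Suc m := w)) ((q(Suc m := 0)) k)"
        using k bd bdw z0 y0 q(2) by (cases "k = Suc m") force+
      show "(q(Suc m := 0)) k \<noteq> 0 \<longrightarrow> g (\<sigma> k) = Suc (g (\<sigma> ((q(Suc m := 0)) k)))"
        using k gq by auto
    qed (use zk w1 w2 z0 q(2) in \<open>auto simp: le_Suc_eq G_def\<close>)
    then show ?thesis by blast
  next
    case False
    define A where "A = {i \<in> {1..m} - q ` {1..m}. a i \<noteq> 0}"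
    define i0 where "i0 = Max A"
    have "i0 \<in> A" unfolding i0_def using False by (intro Max_in) (auto simp: A_def)
    then have i0: "i0 \<in> {1..m}" "i0 \<notin> q ` {1..m}" "a i0 \<noteq> 0" unfolding A_def by auto
    have q0: "q i0 = 0" using aq i0(3) by blast
    have G: "G = Suc (g (\<sigma> i0))" using a i0(3) by blast
    have le: "i \<le> i0" if "i \<in> A" for i
      unfolding i0_def using that by (intro Max_ge) (auto simp: A_def)
    have yA: "y = (\<lambda>\<tau>. \<Sum>i\<in>A. a i * z i \<tau>)"
      unfolding y_def A_def by (intro ext sum.mono_neutral_right) auto
    have y1: "chain i0 (g (\<sigma> i0)) y" unfolding yA
    proof (rule chain_comb)
      fix i assume i: "i \<in> A"
      then have "i \<in> {1..m}" "G = Suc (g (\<sigma> i))" using a unfolding A_def by auto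
      then show "chain i0 (g (\<sigma> i0)) (z i)" using zk(2)[of i] le[OF i] G chain_mono by auto
    qed
    have y2: "y (\<sigma> i0) \<noteq> 0"
    proof -
      have "z i (\<sigma> i0) = 0" if "i \<in> A - {i0}" for i
      proof -
        have "i < i0" "i \<in> {1..m}" using that le unfolding A_def by force+
        moreover have "\<sigma> i0 \<notin> \<sigma> ` {1..i}" using inj_\<sigma> calculation i0(1) m by (auto dest!: inj_onD)
        ultimately show ?thesis using zk(2)[of i] unfolding chain_def by fastforce
      qed
      then have "y (\<sigma> i0) = a i0 * z i0 (\<sigma> i0)"
        unfolding yA using \<open>i0 \<in> A\<close> by (subst sum.remove[of _ i0]) (auto simp: A_def intro!: sum.neutral)
      then show ?thesis using i0 zk by auto
    qed
    have bdy: "bd y = (\<lambda>_. 0)" using bd_bd bdw by metis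
    \<comment> \<open>The chain \<open>y\<close> may replace \<open>z i0\<close> because its latest
      simplex is also the one with index i0; after the replacement the boundary of \<open>w\<close>
      is a member of the basis.\<close>
    define z' where "z' = z(Suc m := w, i0 := y)"
    define q' where "q' = q(Suc m := i0)"
    have "paired_basis (Suc m) z' q'"
      unfolding paired_basis_def triangular_def
    proof (intro conjI ballI)
      show "inj_on q' {k \<in> {1..Suc m}. q' k \<noteq> 0}"
        using q(1) i0(2) unfolding q'_def by (auto simp: inj_on_def le_Suc_eq)
    next
      fix k assume k: "k \<in> {1..Suc m}"
      show "bd (z' k) = z' (q' k)"
      proof -
        consider "k = Suc m" | "k = i0" | "k \<in> {1..m}" "k \<noteq> i0" using k by force
        then show ?thesis
        proof cases
          case 1 then show ?thesis using bdw i0 by (auto simp: z'_def q'_def)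
        next
          case 2 then show ?thesis using bdy i0 q0 z0 by (auto simp: z'_def q'_def)
        next
          case 3
          \<comment> \<open>The index i0 was not in the image of q, so no older pairing refers to
            the replaced chain.\<close>
          then have "q k \<noteq> i0" "q k < k" using i0(2) q(2) by auto
          then show ?thesis using 3 bd by (auto simp: z'_def q'_def)
        qed
      qed
      show "q' k \<noteq> 0 \<longrightarrow> g (\<sigma> k) = Suc (g (\<sigma> (q' k)))"
        using k gq G unfolding q'_def G_def by auto
    qed (use zk w1 w2 y1 y2 z0 q(2) i0 in \<open>auto simp: le_Suc_eq G_def z'_def q'_def\<close>)
    then show ?thesis by blast
  qed
qed

lemma paired_basis_mono:
  assumes "paired_basis m z q" "m' \<le> m"
  shows "paired_basis m' z q"
proof -
  have "inj_on q {k \<in> {1..m'}. q k \<noteq> 0}"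
    by (rule inj_on_subset[of _ "{k \<in> {1..m}. q k \<noteq> 0}"]) (use assms in \<open>auto simp: paired_basis_def\<close>)
  then show ?thesis using assms triangular_mono[of m z m'] unfolding paired_basis_def by auto
qed

section \<open>Coordinates with respect to a triangular basis\<close>

definition indicator_coeffs :: "(nat \<Rightarrow> 'b \<Rightarrow> 'k) \<Rightarrow> nat \<Rightarrow> nat \<Rightarrow> 'k" where
  "indicator_coeffs z k = (SOME a. (\<lambda>\<tau>. if \<tau> = \<sigma> k then 1 else 0) = (\<lambda>\<tau>. \<Sum>i\<in>{1..N}. a i * z i \<tau>))"

text \<open>Coefficients are chosen for single simplices only and extended linearly. Linearity thus
  holds by construction; choosing an expansion of each chain separately would require uniqueness
  first.\<close>

definition coord :: "(nat \<Rightarrow> 'b \<Rightarrow> 'k) \<Rightarrow> nat \<Rightarrow> ('b \<Rightarrow> 'k) \<Rightarrow> 'k" where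
  "coord z i c = (\<Sum>k\<in>{1..N}. c (\<sigma> k) * indicator_coeffs z k i)"

lemma coord_add: "coord z i (\<lambda>\<tau>. c \<tau> + c' \<tau>) = coord z i c + coord z i c'"
  unfolding coord_def by (simp add: distrib_right sum.distrib)

lemma coord_scale: "coord z i (\<lambda>\<tau>. a * c \<tau>) = a * coord z i c"
  unfolding coord_def by (simp add: sum_distrib_left mult.assoc)

lemma coord_zero: "coord z i (\<lambda>_. 0) = 0"
  unfolding coord_def by simp

lemma coord_comb: "coord z i (\<lambda>\<tau>. \<Sum>k\<in>S. a k * y k \<tau>) = (\<Sum>k\<in>S. a k * coord z i (y k))"
proof -
  have "coord z i (\<lambda>\<tau>. \<Sum>k\<in>S. a k * y k \<tau>)
      = (\<Sum>l\<in>{1..N}. \<Sum>k\<in>S. a k * (y k (\<sigma> l) * indicator_coeffs z l i))"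
    unfolding coord_def by (simp add: sum_distrib_right mult.assoc)
  also have "\<dots> = (\<Sum>k\<in>S. \<Sum>l\<in>{1..N}. a k * (y k (\<sigma> l) * indicator_coeffs z l i))"
    by (rule sum.swap)
  finally show ?thesis unfolding coord_def by (simp add: sum_distrib_left)
qed

text \<open>Chains of mixed degree are allowed, since the expansion is carried out simplex by
  simplex and a single simplex is homogeneous.\<close>

lemma coord_expand:
  assumes z: "triangular N z" and c: "\<And>\<tau>. c \<tau> \<noteq> 0 \<Longrightarrow> \<tau> \<in> \<sigma> ` {1..N}"
  shows "c \<tau> = (\<Sum>i\<in>{1..N}. coord z i c * z i \<tau>)"
proof -
  have e: "(if \<tau> = \<sigma> k then 1 else 0) = (\<Sum>i\<in>{1..N}. indicator_coeffs z k i * z i \<tau>)"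
    if k: "k \<in> {1..N}" for k
  proof -
    have "chain N (g (\<sigma> k)) (\<lambda>\<tau>. if \<tau> = \<sigma> k then 1 else 0)"
      using k unfolding chain_def by auto
    from triangular_expand[OF order_refl z this]
    have "\<exists>a. (\<lambda>\<tau>. if \<tau> = \<sigma> k then 1 else 0) = (\<lambda>\<tau>. \<Sum>i\<in>{1..N}. a i * z i \<tau>)" by blast
    then have "(\<lambda>\<tau>. if \<tau> = \<sigma> k then 1 else 0) = (\<lambda>\<tau>. \<Sum>i\<in>{1..N}. indicator_coeffs z k i * z i \<tau>)"
      unfolding indicator_coeffs_def by (rule someI_ex)
    then show ?thesis by meson
  qed
  have "c \<tau> = (\<Sum>k\<in>{1..N}. c (\<sigma> k) * (if \<tau> = \<sigma> k then 1 else 0))"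
  proof (cases "\<tau> \<in> \<sigma> ` {1..N}")
    case True
    then obtain l where l: "l \<in> {1..N}" "\<tau> = \<sigma> l" by blast
    then have "(\<Sum>k\<in>{1..N}. c (\<sigma> k) * (if \<tau> = \<sigma> k then 1 else 0)) = (\<Sum>k\<in>{1..N}. if k = l then c (\<sigma> k) else 0)"
      using inj_\<sigma> by (intro sum.cong) (auto dest: inj_onD)
    then show ?thesis using l by simp
  next
    case False
    then have "c \<tau> = 0" using c by blast
    moreover have "(\<Sum>k\<in>{1..N}. c (\<sigma> k) * (if \<tau> = \<sigma> k then 1 else 0)) = 0"
      using False by (intro sum.neutral) auto
    ultimately show ?thesis by simp
  qed
  also have "\<dots> = (\<Sum>k\<in>{1..N}. \<Sum>i\<in>{1..N}. c (\<sigma> k) * indicator_coeffs z k i * z i \<tau>)"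
    by (intro sum.cong refl) (simp add: e sum_distrib_left mult.assoc del: One_nat_def)
  also have "\<dots> = (\<Sum>i\<in>{1..N}. \<Sum>k\<in>{1..N}. c (\<sigma> k) * indicator_coeffs z k i * z i \<tau>)"
    by (rule sum.swap)
  finally show ?thesis unfolding coord_def by (simp add: sum_distrib_right)
qed

text \<open>By independence, the expansion of \<open>z k\<close> through \<open>coord\<close> must
  agree with its trivial expansion.\<close>

lemma coord_basis:
  assumes z: "triangular N z" and k: "k \<in> {1..N}" and i: "i \<in> {1..N}"
  shows "coord z i (z k) = (if i = k then 1 else 0)"
proof -
  have "chain k (g (\<sigma> k)) (z k)" using z k unfolding triangular_def by auto
  then have "z k \<tau> = (\<Sum>i\<in>{1..N}. coord z i (z k) * z i \<tau>)" for \<tau>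
    using k by (intro coord_expand[OF z]) (force simp: chain_def)
  moreover have "z k \<tau> = (\<Sum>i\<in>{1..N}. (if i = k then 1 else 0) * z i \<tau>)" for \<tau>
    using k by (simp add: if_distrib[of "\<lambda>x. x * _"] cong: if_cong)
  ultimately have "(\<Sum>i\<in>{1..N}. (coord z i (z k) - (if i = k then 1 else 0)) * z i \<tau>) = 0" for \<tau>
    unfolding left_diff_distrib sum_subtractf by (metis right_minus_eq)
  from triangular_independent[OF order_refl z this i] show ?thesis by simp
qed

text \<open>The classes of the \<open>z i\<close> with \<open>i\<close> in \<open>active q j\<close> form a basis of the homology of the \<open>j\<close>-th
  frame.\<close>

definition active :: "(nat \<Rightarrow> nat) \<Rightarrow> nat \<Rightarrow> nat set" where
  "active q j = {i \<in> {1..j}. q i = 0 \<and> i \<notin> q ` {1..j}}"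

section \<open>Homology of a frame in the coordinates of a paired basis\<close>

lemma active_chain:
  assumes "paired_basis N z q" "j \<le> N" "i \<in> active q j"
  shows "chain j (g (\<sigma> i)) (z i)" "bd (z i) = (\<lambda>_. 0)"
  using assms chain_mono[of i "g (\<sigma> i)" "z i" j]
  unfolding paired_basis_def active_def triangular_def by auto

text \<open>Boundaries from frame j are combinations of the \<open>z (q k)\<close> with k \<le> j,
  and an active index is none of these q k. Active coordinates are therefore well defined on
  homology classes.\<close>

lemma coord_boundary:
  assumes B: "paired_basis N z q" and j: "j \<le> N" and i: "i \<in> active q j" and b: "chain j h b"
  shows "coord z i (bd b) = 0"
proof -
  have tri: "triangular N z" and z0: "z 0 = (\<lambda>_. 0)"
    and q: "\<And>k. k \<in> {1..N} \<Longrightarrow> q k < k" "\<And>k. k \<in> {1..N} \<Longrightarrow> bd (z k) = z (q k)"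
    using B unfolding paired_basis_def by auto
  obtain a where "b = (\<lambda>\<tau>. \<Sum>k\<in>{1..j}. a k * z k \<tau>)"
    using triangular_expand[OF j triangular_mono[OF tri j] b] by blast
  then have "coord z i (bd b) = (\<Sum>k\<in>{1..j}. a k * coord z i (bd (z k)))"
    by (simp only: bd_comb coord_comb)
  also have "\<dots> = 0"
  proof (intro sum.neutral ballI)
    fix k assume k: "k \<in> {1..j}"
    then have "bd (z k) = z (q k)" "q k < k" "i \<noteq> q k" "i \<in> {1..N}"
      using q j i unfolding active_def by auto
    then have "coord z i (z (q k)) = 0"
      using coord_basis[OF tri, of "q k" i] k j z0 coord_zero by (cases "q k = 0") auto
    then show "a k * coord z i (bd (z k)) = 0" using \<open>bd (z k) = _\<close> by simp
  qed
  finally show ?thesis .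
qed

text \<open>Converse of the well-definedness: a cycle has no coefficients at noncycles and, by
  assumption, none at active indices, so it is a combination of boundaries \<open>z (q k)\<close>
  with k \<le> j.\<close>

lemma coord_zero_imp_boundary:
  assumes B: "paired_basis N z q" and j: "j \<le> N" and c: "chain j h c" "bd c = (\<lambda>_. 0)"
    and u: "\<And>i. i \<in> active q j \<Longrightarrow> g (\<sigma> i) = h \<Longrightarrow> coord z i c = 0"
  shows "\<exists>b. chain j (Suc h) b \<and> bd b = c"
proof -
  have tri: "triangular N z" and z0: "z 0 = (\<lambda>_. 0)"
    and q: "\<And>k. k \<in> {1..N} \<Longrightarrow> bd (z k) = z (q k)"
    and gq: "\<And>k. k \<in> {1..N} \<Longrightarrow> q k \<noteq> 0 \<Longrightarrow> g (\<sigma> k) = Suc (g (\<sigma> (q k)))"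
    using B unfolding paired_basis_def by auto
  obtain a where a: "\<And>i. a i \<noteq> 0 \<Longrightarrow> i \<in> {1..j} \<and> g (\<sigma> i) = h"
    and ca: "c = (\<lambda>\<tau>. \<Sum>k\<in>{1..j}. a k * z k \<tau>)"
    using triangular_expand[OF j triangular_mono[OF tri j] c(1)] by blast
  note Bj = paired_basis_mono[OF B j]
  have coa: "coord z i c = a i" if i: "i \<in> {1..j}" for i
  proof -
    have "coord z i c = (\<Sum>k\<in>{1..j}. a k * coord z i (z k))" unfolding ca by (rule coord_comb)
    also have "\<dots> = (\<Sum>k\<in>{1..j}. if i = k then a k else 0)"
      using i j by (intro sum.cong) (auto simp: coord_basis[OF tri])
    finally show ?thesis using i by simp
  qed
  have aq: "a i = 0" if "i \<notin> q ` {1..j}" for i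
  proof (cases "i \<in> {1..j} \<and> g (\<sigma> i) = h")
    case True
    show ?thesis
    proof (cases "q i = 0")
      case True
      then have "i \<in> active q j" using that \<open>i \<in> {1..j} \<and> _\<close> unfolding active_def by auto
      then show ?thesis using u coa \<open>i \<in> {1..j} \<and> _\<close> by metis
    next
      case False
      then show ?thesis using paired_basis_cycle_coeffs[OF j Bj] c(2) True unfolding ca by blast
    qed
  qed (use a in blast)
  \<comment> \<open>Move each coefficient from \<open>z (q k)\<close> to \<open>z k\<close>, whose
    boundary is \<open>z (q k)\<close>.\<close>
  define b where "b = (\<lambda>\<tau>. \<Sum>k\<in>{1..j}. a (q k) * z k \<tau>)"
  have "bd b \<tau> = c \<tau>" for \<tau>
  proof -
    have "bd b \<tau> = (\<Sum>k\<in>{1..j}. a (q k) * z (q k) \<tau>)"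
      unfolding b_def bd_comb using q j by (intro sum.cong) auto
    also have "\<dots> = (\<Sum>i\<in>{1..j} \<inter> q ` {1..j}. a i * z i \<tau>)" by (rule paired_comb_reindex[OF Bj])
    also have "\<dots> = c \<tau>" unfolding ca using aq by (intro sum.mono_neutral_left) auto
    finally show ?thesis .
  qed
  moreover have "chain j (Suc h) b" unfolding b_def
  proof (rule chain_comb)
    fix k assume k: "k \<in> {1..j}" "a (q k) \<noteq> 0"
    then have "q k \<noteq> 0" "g (\<sigma> (q k)) = h" using a by fastforce+
    then have "g (\<sigma> k) = Suc h" using gq k j by auto
    moreover have "chain k (g (\<sigma> k)) (z k)" using tri k j unfolding triangular_def by auto
    ultimately show "chain j (Suc h) (z k)" using k chain_mono by auto
  qed
  ultimately show ?thesis by blast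
qed

text \<open>Within the first i + 1 simplices only the last one can have the i-th as a face, so
  nothing cancels the i-th simplex in the boundary of \<open>z (Suc i)\<close>. That boundary is
  \<open>z (q (Suc i))\<close>, whose support ends at q (Suc i); hence i \<le> q (Suc i) < Suc
  i.\<close>

lemma paired_with_last_face:
  assumes B: "paired_basis N z q" and i: "Suc i \<in> {1..N}" "1 \<le> i" and D: "D (\<sigma> i) (\<sigma> (Suc i)) \<noteq> 0"
  shows "q (Suc i) = i"
proof -
  have tri: "triangular N z" and z0: "z 0 = (\<lambda>_. 0)"
    and q: "q (Suc i) < Suc i" "bd (z (Suc i)) = z (q (Suc i))"
    using B i unfolding paired_basis_def by auto
  have zi: "z (Suc i) (\<sigma> (Suc i)) \<noteq> 0" "chain (Suc i) (g (\<sigma> (Suc i))) (z (Suc i))"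
    using tri i unfolding triangular_def by auto
  have "D (\<sigma> i) (\<sigma> k) * z (Suc i) (\<sigma> k) = 0" if k: "k \<in> {1..N} - {Suc i}" for k
  proof (rule ccontr)
    assume *: "D (\<sigma> i) (\<sigma> k) * z (Suc i) (\<sigma> k) \<noteq> 0"
    then have "\<sigma> i \<in> \<sigma> ` {1..<k}" "\<sigma> k \<in> \<sigma> ` {1..Suc i}"
      using D_earlier[of k] zi(2) k unfolding chain_def by auto
    then obtain l l' where l: "l \<in> {1..<k}" "\<sigma> i = \<sigma> l" "l' \<in> {1..Suc i}" "\<sigma> k = \<sigma> l'" by blast
    then have "i = l" "k = l'" using inj_\<sigma> k i by (auto dest: inj_onD)
    then have "i < k" "k \<le> Suc i" using l by auto
    then show False using k by auto
  qed
  then have "bd (z (Suc i)) (\<sigma> i) = D (\<sigma> i) (\<sigma> (Suc i)) * z (Suc i) (\<sigma> (Suc i))"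
    unfolding bd_def by (subst sum.remove[of _ "Suc i"]) (use i in \<open>simp_all add: sum.neutral del: One_nat_def\<close>)
  then have nz: "z (q (Suc i)) (\<sigma> i) \<noteq> 0" using D zi q(2) by auto
  then have "q (Suc i) \<noteq> 0" using z0 by metis
  then have "chain (q (Suc i)) (g (\<sigma> (q (Suc i)))) (z (q (Suc i)))"
    using tri q i unfolding triangular_def by auto
  then have "\<sigma> i \<in> \<sigma> ` {1..q (Suc i)}" using nz unfolding chain_def by auto
  then show ?thesis using q(1) inj_\<sigma> i by (auto dest!: inj_onD)
qed

end

section \<open>Homology of a simplexwise filtration\<close>

lemma bit_add_self: "x + x = (0::bit)"
  by simp

lemma bit_add_cancel: "x + y + y = (x::bit)" "y + (x + y) = x" "x + (y + z) + z = x + y"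
proof -
  show *: "x + y + y = x" for x y :: bit by (simp only: add.assoc bit_add_self add_0_right)
  show "y + (x + y) = x" by (metis * add.commute)
  show "x + (y + z) + z = x + y" by (metis * add.assoc)
qed

lemma sum_of_bool_bit: "finite A \<Longrightarrow> (\<Sum>x\<in>A. of_bool (P x) :: bit) = of_nat (card {x\<in>A. P x})"
  by (simp add: of_bool_def flip: sum.inter_filter)

text \<open>The colex order enters the homology computation only through
  \<open>face_earlier\<close>, which makes every frame a subcomplex.\<close>

locale simplexwise_filtration =
  fixes V :: "'a set" and K :: "'a set set" and N :: nat and \<sigma> :: "nat \<Rightarrow> 'a set"
  assumes K: "simplicial_complex V K"
    and enum: "bij_betw \<sigma> {1..N} K"
    and face_earlier: "\<And>i j. i \<in> {1..N} \<Longrightarrow> j \<in> {1..N} \<Longrightarrow> \<sigma> i \<subset> \<sigma> j \<Longrightarrow> i < j"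
begin

text \<open>Requiring the face to be in K excludes the empty face of a vertex, in accordance with
  unreduced homology.\<close>

definition incidence :: "'a set \<Rightarrow> 'a set \<Rightarrow> bit" where
  "incidence \<tau> \<rho> = of_bool (\<tau> \<in> K \<and> \<tau> \<subset> \<rho> \<and> card \<rho> = Suc (card \<tau>))"

lemma simplex: "\<tau> \<in> K \<Longrightarrow> finite \<tau> \<and> \<tau> \<noteq> {} \<and> 0 < card \<tau>"
  using K unfolding simplicial_complex_def by (auto simp: card_gt_0_iff)

lemma face_in_K: "\<rho> \<in> K \<Longrightarrow> \<tau> \<noteq> {} \<Longrightarrow> \<tau> \<subseteq> \<rho> \<Longrightarrow> \<tau> \<in> K"
  using K unfolding simplicial_complex_def by blast

text \<open>A face of codimension two lies in exactly two intermediate faces, and 2 = 0 in the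
  field.\<close>

lemma incidence_incidence:
  assumes \<rho>: "\<rho> \<in> K"
  shows "(\<Sum>\<mu>\<in>K. incidence \<tau> \<mu> * incidence \<mu> \<rho>) = 0"
proof -
  let ?M = "{\<mu> \<in> K. \<tau> \<in> K \<and> \<tau> \<subset> \<mu> \<and> card \<mu> = Suc (card \<tau>) \<and> \<mu> \<subset> \<rho> \<and> card \<rho> = Suc (card \<mu>)}"
  have fin: "finite K" using enum bij_betw_finite by blast
  have "(\<Sum>\<mu>\<in>K. incidence \<tau> \<mu> * incidence \<mu> \<rho>) =
      (\<Sum>\<mu>\<in>K. of_bool (\<tau> \<in> K \<and> \<tau> \<subset> \<mu> \<and> card \<mu> = Suc (card \<tau>) \<and> \<mu> \<subset> \<rho> \<and> card \<rho> = Suc (card \<mu>)))"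
    unfolding incidence_def of_bool_conj[symmetric] by (intro sum.cong) auto
  also have "\<dots> = of_nat (card ?M)" by (rule sum_of_bool_bit[OF fin])
  also have "\<dots> = 0"
  proof (cases "\<tau> \<in> K \<and> \<tau> \<subseteq> \<rho> \<and> card \<rho> = Suc (Suc (card \<tau>))")
    case True
    have f: "finite \<rho>" "finite \<tau>" "\<tau> \<noteq> {}" using \<rho> True simplex by auto
    \<comment> \<open>An intermediate face arises by adding one of the two missing vertices.\<close>
    have "?M = (\<lambda>v. insert v \<tau>) ` (\<rho> - \<tau>)"
    proof (intro equalityI subsetI)
      fix \<mu> assume \<mu>: "\<mu> \<in> ?M"
      then have "card (\<mu> - \<tau>) = 1" using f by (subst card_Diff_subset) auto
      then obtain v where "\<mu> - \<tau> = {v}" by (auto simp: card_1_singleton_iff)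
      then have "\<mu> = insert v \<tau>" "v \<in> \<rho> - \<tau>" using \<mu> by auto
      then show "\<mu> \<in> (\<lambda>v. insert v \<tau>) ` (\<rho> - \<tau>)" by blast
    next
      fix \<mu> assume "\<mu> \<in> (\<lambda>v. insert v \<tau>) ` (\<rho> - \<tau>)"
      then obtain v where v: "\<mu> = insert v \<tau>" "v \<in> \<rho>" "v \<notin> \<tau>" by blast
      then have "card \<mu> = Suc (card \<tau>)" "\<mu> \<subseteq> \<rho>" "\<mu> \<in> K" using f True \<rho> face_in_K[of \<rho> \<mu>] by auto
      then show "\<mu> \<in> ?M" using v True by auto
    qed
    moreover have "inj_on (\<lambda>v. insert v \<tau>) (\<rho> - \<tau>)" by (auto simp: inj_on_def)
    ultimately have "card ?M = card (\<rho> - \<tau>)" by (simp add: card_image)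
    also have "\<dots> = 2" using True f by (subst card_Diff_subset) auto
    finally have "card ?M = 2" .
    then show ?thesis by simp
  next
    case False
    then have "?M = {}" by auto
    then show ?thesis by (metis card.empty of_nat_0)
  qed
  finally show ?thesis .
qed

text \<open>The degree is the dimension; simplices are nonempty, so the subtraction is not truncated
  on K.\<close>

sublocale filtered_complex N \<sigma> "\<lambda>\<tau>. card \<tau> - 1" incidence
proof
  show "inj_on \<sigma> {1..N}" using enum by (rule bij_betw_imp_inj_on)
next
  fix \<tau> k assume k: "k \<in> {1..N}" and "incidence \<tau> (\<sigma> k) \<noteq> 0"
  then have *: "\<tau> \<in> K" "\<tau> \<subset> \<sigma> k" "card (\<sigma> k) = Suc (card \<tau>)"
    unfolding incidence_def by (auto split: if_splits)
  obtain i where i: "i \<in> {1..N}" "\<tau> = \<sigma> i" using *(1) enum unfolding bij_betw_def by auto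
  then have "i < k" using face_earlier k *(2) by blast
  then have "\<tau> \<in> \<sigma> ` {1..<k}" using i by auto
  then show "\<tau> \<in> \<sigma> ` {1..<k} \<and> card (\<sigma> k) - 1 = Suc (card \<tau> - 1)" using * simplex[of \<tau>] by auto
next
  fix \<tau> l assume l: "l \<in> {1..N}"
  then have "\<sigma> l \<in> K" using enum bij_betwE by blast
  have "(\<Sum>k\<in>{1..N}. incidence \<tau> (\<sigma> k) * incidence (\<sigma> k) (\<sigma> l)) = (\<Sum>\<mu>\<in>K. incidence \<tau> \<mu> * incidence \<mu> (\<sigma> l))"
    by (rule sum.reindex_bij_betw[OF enum])
  also have "\<dots> = 0" by (rule incidence_incidence) fact
  finally show "(\<Sum>k\<in>{1..N}. incidence \<tau> (\<sigma> k) * incidence (\<sigma> k) (\<sigma> l)) = 0" .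
qed

section \<open>Chains, boundaries and cycles of the frames\<close>

definition frame :: "nat \<Rightarrow> 'a set set" where
  "frame j = \<sigma> ` {1..j}"

lemma simplices_frame:
  assumes "j \<le> N"
  shows "\<tau> \<in> simplices (frame j) p \<longleftrightarrow> \<tau> \<in> \<sigma> ` {1..j} \<and> card \<tau> - 1 = p"
proof -
  have "\<sigma> ` {1..j} \<subseteq> K" using assms enum unfolding bij_betw_def by auto
  then show ?thesis using simplex unfolding simplices_def frame_def by fastforce
qed

lemma carrier_chain_module:
  "j \<le> N \<Longrightarrow> carrier (chain_module (frame j) p) = {c. chain j p c}"
  unfolding chain_module_def chain_def partial_object.simps simplices_frame by blast

lemma boundary_frame:
  assumes j: "j \<le> N" and c: "chain j (Suc p) c"
  shows "boundary (frame j) p c = bd c"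
proof
  fix \<tau>
  show "boundary (frame j) p c \<tau> = bd c \<tau>"
  proof (cases "\<tau> \<in> simplices (frame j) p")
    case True
    have sub: "\<sigma> ` {1..j} \<subseteq> K" using j enum unfolding bij_betw_def by auto
    have \<tau>: "\<tau> \<in> \<sigma> ` {1..j}" "card \<tau> - 1 = p" using True simplices_frame[OF j] by auto
    then have \<tau>K: "\<tau> \<in> K" using sub by auto
    have fin: "finite K" using enum bij_betw_finite by blast
    have "bd c \<tau> = (\<Sum>\<rho>\<in>K. incidence \<tau> \<rho> * c \<rho>)"
      unfolding bd_def by (rule sum.reindex_bij_betw[OF enum])
    also have "\<dots> = (\<Sum>\<rho> | \<rho> \<in> simplices (frame j) (Suc p) \<and> \<tau> \<subset> \<rho>. incidence \<tau> \<rho> * c \<rho>)"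
    proof (rule sum.mono_neutral_right[OF fin])
      show "{\<rho>. \<rho> \<in> simplices (frame j) (Suc p) \<and> \<tau> \<subset> \<rho>} \<subseteq> K"
        using sub simplices_frame[OF j] by auto
      show "\<forall>\<rho>\<in>K - {\<rho>. \<rho> \<in> simplices (frame j) (Suc p) \<and> \<tau> \<subset> \<rho>}. incidence \<tau> \<rho> * c \<rho> = 0"
      proof
        fix \<rho> assume \<rho>: "\<rho> \<in> K - {\<rho>. \<rho> \<in> simplices (frame j) (Suc p) \<and> \<tau> \<subset> \<rho>}"
        show "incidence \<tau> \<rho> * c \<rho> = 0"
        proof (cases "\<tau> \<subset> \<rho>")
          case True
          then have "c \<rho> = 0" using \<rho> c simplices_frame[OF j] unfolding chain_def by blast
          then show ?thesis by simp
        next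
          case False
          then have "incidence \<tau> \<rho> = 0" unfolding incidence_def by simp
          then show ?thesis by simp
        qed
      qed
    qed
    also have "\<dots> = (\<Sum>\<rho> | \<rho> \<in> simplices (frame j) (Suc p) \<and> \<tau> \<subset> \<rho>. c \<rho>)"
    proof (rule sum.cong[OF refl])
      fix \<rho> assume \<rho>: "\<rho> \<in> {\<rho>. \<rho> \<in> simplices (frame j) (Suc p) \<and> \<tau> \<subset> \<rho>}"
      then have "card \<rho> - 1 = Suc p" "\<rho> \<in> K" using simplices_frame[OF j] sub by auto
      then have "card \<rho> = Suc (card \<tau>)" using \<tau> simplex[OF \<tau>K] by auto
      then have "incidence \<tau> \<rho> = 1" using \<rho> \<tau>K unfolding incidence_def by simp
      then show "incidence \<tau> \<rho> * c \<rho> = c \<rho>" by simp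
    qed
    finally show ?thesis using True unfolding boundary_def by simp
  next
    case False
    \<comment> \<open>Off the p-simplices of the frame \<open>boundary\<close> is 0 by definition;
      for \<open>bd\<close> this holds because faces come earlier and have dimension p.\<close>
    have "bd c \<tau> = 0"
    proof (rule ccontr)
      assume "bd c \<tau> \<noteq> 0"
      then have "\<tau> \<in> \<sigma> ` {1..j - 1}" "card \<tau> - 1 = p" using bd_support[OF c j] by auto
      then show False using False simplices_frame[OF j] by auto
    qed
    then show ?thesis using False unfolding boundary_def by simp
  qed
qed

lemma boundaries_frame:
  assumes "j \<le> N"
  shows "boundaries (frame j) p = bd ` {b. chain j (Suc p) b}"
  unfolding boundaries_def carrier_chain_module[OF assms] by (rule image_cong) (simp_all add: boundary_frame assms)

text \<open>The separate clause for degree 0 disappears, since \<open>bd\<close> kills chains of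
  degree 0 anyway.\<close>

lemma cycles_frame:
  assumes "j \<le> N"
  shows "cycles (frame j) p = {c. chain j p c \<and> bd c = (\<lambda>_. 0)}"
proof (cases p)
  case 0
  then show ?thesis
    unfolding 0 cycles.simps carrier_chain_module[OF assms] using bd_chain_0[OF _ assms] by blast
next
  case (Suc q)
  then show ?thesis
    unfolding Suc cycles.simps carrier_chain_module[OF assms] mem_Collect_eq
    by (intro Collect_cong conj_cong refl) (simp only: boundary_frame[OF assms])
qed

end

section \<open>Homology modules as explicit cosets\<close>

definition homology_class :: "'a set set \<Rightarrow> nat \<Rightarrow> ('a set \<Rightarrow> bit) \<Rightarrow> ('a set \<Rightarrow> bit) set" where
  "homology_class L p z = (\<lambda>b \<rho>. b \<rho> + z \<rho>) ` boundaries L p"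

lemma coset_chain_module:
  "boundaries L p +>\<^bsub>chain_module L q\<^esub> z = homology_class L p z"
  unfolding a_r_coset_def r_coset_def homology_class_def chain_module_def by auto

lemma coset_chain_module':
  "boundaries L p +>\<^bsub>(chain_module L q)\<lparr>carrier := C\<rparr>\<^esub> z = homology_class L p z"
  unfolding a_r_coset_def r_coset_def homology_class_def chain_module_def by auto

lemma carrier_homology_module:
  "carrier (homology_module L p) = homology_class L p ` cycles L p"
proof -
  have "carrier (homology_module L p)
      = (\<Union>a\<in>cycles L p. {boundaries L p +>\<^bsub>(chain_module L p)\<lparr>carrier := cycles L p\<rparr>\<^esub> a})"
    unfolding homology_module_def quotient_module_def A_RCOSETS_def RCOSETS_def a_r_coset_def by simp
  then show ?thesis unfolding coset_chain_module' by auto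
qed

context
  fixes L :: "'a set set" and p :: nat
begin

lemma zero_in_boundaries: "(\<lambda>_. 0) \<in> boundaries L p"
  unfolding boundaries_def
  by (rule image_eqI[of _ _ "\<lambda>_. 0"]) (auto simp: boundary_def chain_module_def)

lemma boundaries_add:
  assumes "b \<in> boundaries L p" "b' \<in> boundaries L p"
  shows "(\<lambda>\<rho>. b \<rho> + b' \<rho>) \<in> boundaries L p"
proof -
  obtain c c' where c: "c \<in> carrier (chain_module L (Suc p))" "b = boundary L p c"
    "c' \<in> carrier (chain_module L (Suc p))" "b' = boundary L p c'"
    using assms unfolding boundaries_def by auto
  show ?thesis unfolding boundaries_def
  proof (rule image_eqI)
    show "(\<lambda>\<rho>. b \<rho> + b' \<rho>) = boundary L p (\<lambda>\<rho>. c \<rho> + c' \<rho>)"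
    proof
      fix \<rho>
      show "b \<rho> + b' \<rho> = boundary L p (\<lambda>\<rho>. c \<rho> + c' \<rho>) \<rho>"
        unfolding c(2,4) boundary_def sum.distrib
        by (cases "\<rho> \<in> simplices L p") (simp_all only: if_True if_False add_0_right)
    qed
    show "(\<lambda>\<rho>. c \<rho> + c' \<rho>) \<in> carrier (chain_module L (Suc p))"
      using c unfolding chain_module_def by simp
  qed
qed

text \<open>In characteristic 2 the sum of two chains is also their difference, so one inclusion,
  used twice, suffices.\<close>

lemma homology_class_eqI:
  assumes "(\<lambda>\<rho>. z \<rho> + z' \<rho>) \<in> boundaries L p"
  shows "homology_class L p z = homology_class L p z'"
proof -
  have *: "homology_class L p z \<subseteq> homology_class L p z'"
    if "(\<lambda>\<rho>. z \<rho> + z' \<rho>) \<in> boundaries L p" for z z'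
  proof
    fix x assume "x \<in> homology_class L p z"
    then obtain b where b: "b \<in> boundaries L p" "x = (\<lambda>\<rho>. b \<rho> + z \<rho>)" unfolding homology_class_def by auto
    have "x = (\<lambda>\<rho>. (b \<rho> + (z \<rho> + z' \<rho>)) + z' \<rho>)"
      unfolding b(2) bit_add_cancel(3) ..
    then show "x \<in> homology_class L p z'"
      unfolding homology_class_def
      by (rule image_eqI[where x = "\<lambda>\<rho>. b \<rho> + (z \<rho> + z' \<rho>)"]) (rule boundaries_add[OF b(1) that])
  qed
  have "(\<lambda>\<rho>. z' \<rho> + z \<rho>) \<in> boundaries L p" using assms by (simp only: add.commute)
  from *[OF assms] *[OF this] show ?thesis by (rule subset_antisym)
qed

lemma homology_class_self: "z \<in> homology_class L p z"
  unfolding homology_class_def using zero_in_boundaries by (auto intro!: image_eqI[of _ _ "\<lambda>_. 0"])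

lemma homology_class_diff:
  assumes "z' \<in> homology_class L p z"
  shows "(\<lambda>\<rho>. z \<rho> + z' \<rho>) \<in> boundaries L p"
proof -
  obtain b where b: "b \<in> boundaries L p" "z' = (\<lambda>\<rho>. b \<rho> + z \<rho>)"
    using assms unfolding homology_class_def by auto
  have "(\<lambda>\<rho>. z \<rho> + z' \<rho>) = b" unfolding b(2) bit_add_cancel(2) ..
  then show ?thesis using b(1) by simp
qed

lemma zero_homology_module: "\<zero>\<^bsub>homology_module L p\<^esub> = homology_class L p (\<lambda>_. 0)"
  unfolding homology_module_def quotient_module_def homology_class_def add_0_right by simp

lemma add_homology_module:
  "homology_class L p z \<oplus>\<^bsub>homology_module L p\<^esub> homology_class L p z' = homology_class L p (\<lambda>\<rho>. z \<rho> + z' \<rho>)"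
proof -
  have "homology_class L p z \<oplus>\<^bsub>homology_module L p\<^esub> homology_class L p z' =
      (\<Union>b\<in>boundaries L p. \<Union>b'\<in>boundaries L p. {\<lambda>\<rho>. (b \<rho> + z \<rho>) + (b' \<rho> + z' \<rho>)})"
    unfolding homology_module_def quotient_module_def homology_class_def set_add_def set_mult_def chain_module_def
    by simp
  also have "\<dots> = (\<Union>b\<in>boundaries L p. \<Union>b'\<in>boundaries L p. {\<lambda>\<rho>. (b \<rho> + b' \<rho>) + (z \<rho> + z' \<rho>)})"
    by (simp only: add.assoc add.left_commute)
  also have "\<dots> = homology_class L p (\<lambda>\<rho>. z \<rho> + z' \<rho>)"
  proof (intro equalityI subsetI)
    fix x assume "x \<in> (\<Union>b\<in>boundaries L p. \<Union>b'\<in>boundaries L p. {\<lambda>\<rho>. (b \<rho> + b' \<rho>) + (z \<rho> + z' \<rho>)})"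
    then obtain b b' where b: "b \<in> boundaries L p" "b' \<in> boundaries L p"
      and x: "x = (\<lambda>\<rho>. (b \<rho> + b' \<rho>) + (z \<rho> + z' \<rho>))" by blast
    show "x \<in> homology_class L p (\<lambda>\<rho>. z \<rho> + z' \<rho>)"
      unfolding homology_class_def x
      by (rule image_eqI[where x = "\<lambda>\<rho>. b \<rho> + b' \<rho>"]) (rule refl, rule boundaries_add[OF b])
  next
    fix x assume "x \<in> homology_class L p (\<lambda>\<rho>. z \<rho> + z' \<rho>)"
    \<comment> \<open>The added 0 stands for the second boundary in the union on the other
      side.\<close>
    then obtain b where "b \<in> boundaries L p" "x = (\<lambda>\<rho>. (b \<rho> + 0) + (z \<rho> + z' \<rho>))"
      unfolding homology_class_def add_0_right by blast
    then show "x \<in> (\<Union>b\<in>boundaries L p. \<Union>b'\<in>boundaries L p. {\<lambda>\<rho>. (b \<rho> + b' \<rho>) + (z \<rho> + z' \<rho>)})"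
      using zero_in_boundaries by blast
  qed
  finally show ?thesis .
qed

text \<open>The quotient takes a union over all representatives. Each gives the same class: the
  scalar is 0 or 1, so the difference is zero or the boundary b.\<close>

lemma smult_homology_module:
  "a \<odot>\<^bsub>homology_module L p\<^esub> homology_class L p z = homology_class L p (\<lambda>\<rho>. a * z \<rho>)"
proof -
  have eq: "a \<odot>\<^bsub>homology_module L p\<^esub> homology_class L p z =
      (\<Union>b\<in>boundaries L p. homology_class L p (\<lambda>\<rho>. a * (b \<rho> + z \<rho>)))"
    unfolding homology_module_def quotient_module_def coset_chain_module'
    by (simp add: chain_module_def homology_class_def)
  have "homology_class L p (\<lambda>\<rho>. a * (b \<rho> + z \<rho>)) = homology_class L p (\<lambda>\<rho>. a * z \<rho>)"
    if b: "b \<in> boundaries L p" for b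
  proof (rule homology_class_eqI)
    show "(\<lambda>\<rho>. a * (b \<rho> + z \<rho>) + a * z \<rho>) \<in> boundaries L p"
    proof (cases "a = 0")
      case True
      then show ?thesis using zero_in_boundaries by simp
    next
      case False
      then have "a = 1" by (cases a) auto
      then have "(\<lambda>\<rho>. a * (b \<rho> + z \<rho>) + a * z \<rho>) = b" by (simp only: mult_1 bit_add_cancel(1))
      then show ?thesis using b by simp
    qed
  qed
  then show ?thesis unfolding eq using zero_in_boundaries by auto
qed

end

lemma homology_map_class:
  assumes "boundaries L p \<subseteq> boundaries L' p"
  shows "homology_map L' p (homology_class L p z) = homology_class L' p z"
proof -
  have "homology_map L' p (homology_class L p z) = (\<Union>b\<in>boundaries L p. homology_class L' p (\<lambda>\<rho>. b \<rho> + z \<rho>))"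
    unfolding homology_map_def coset_chain_module homology_class_def[of L p z] by simp
  also have "\<dots> = (\<Union>b\<in>boundaries L p. homology_class L' p z)"
  proof (rule SUP_cong[OF refl])
    fix b assume "b \<in> boundaries L p"
    moreover have "(\<lambda>\<rho>. (b \<rho> + z \<rho>) + z \<rho>) = b" by (simp only: bit_add_cancel(1))
    ultimately show "homology_class L' p (\<lambda>\<rho>. b \<rho> + z \<rho>) = homology_class L' p z"
      using assms by (intro homology_class_eqI) auto
  qed
  finally show ?thesis using zero_in_boundaries[of L p] by auto
qed

section \<open>Uniqueness of interval decompositions\<close>

definition interval_support :: "nat set \<Rightarrow> nat \<times> enat \<Rightarrow> nat set" where
  "interval_support I x = {j \<in> I. fst x \<le> j \<and> enat j < snd x}"

definition interval_sum :: "nat set \<Rightarrow> ((nat \<times> enat) \<times> nat) set \<Rightarrow>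
    ('k::field, (nat \<times> enat) \<times> nat \<Rightarrow> 'k) persistence_module" where
  "interval_sum I A = persistence_sum I A (\<lambda>(x, k). interval_module I x)"

lemma interval_module_simps:
  "carrier (pspace (interval_module I x) j) = (if j \<in> interval_support I x then UNIV else {0})"
  "\<zero>\<^bsub>pspace (interval_module I x) j\<^esub> = 0"
  "a \<oplus>\<^bsub>pspace (interval_module I x) j\<^esub> b = a + b"
  "a \<odot>\<^bsub>pspace (interval_module I x) j\<^esub> b = a * b"
  "pmap (interval_module I x) i j a = (if i \<in> interval_support I x \<and> j \<in> interval_support I x then a else 0)"
  unfolding interval_module_def interval_support_def by (cases x; simp add: Let_def)+

lemma interval_sum_simps:
  "finite A \<Longrightarrow> carrier (pspace (interval_sum I A) j) =
     (\<Pi>\<^sub>E t\<in>A. if j \<in> interval_support I (fst t) then UNIV else {0})"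
  "x \<oplus>\<^bsub>pspace (interval_sum I A) j\<^esub> y = (\<lambda>t\<in>A. x t + y t)"
  "a \<odot>\<^bsub>pspace (interval_sum I A) j\<^esub> x = (\<lambda>t\<in>A. a * x t)"
  "pmap (interval_sum I A) i j x =
     (\<lambda>t\<in>A. if i \<in> interval_support I (fst t) \<and> j \<in> interval_support I (fst t) then x t else 0)"
  "pindex (interval_sum I A) = I"
  unfolding interval_sum_def persistence_sum_def direct_sum_module_def
  by (simp_all add: interval_module_simps case_prod_unfold)

lemma decomposes_into_iff:
  "decomposes_into (M :: ('k::field, 'v) persistence_module) B \<longleftrightarrow>
     set_mset B \<subseteq> interval_labels (pindex M) \<and>
     persistence_iso M (interval_sum (pindex M) {(x, k). k < count B x} :: ('k, _) persistence_module)"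
  unfolding decomposes_into_def interval_sum_def by simp

lemma copies_eq_Sigma:
  assumes "set_mset B \<subseteq> X"
  shows "{(x, k). k < count B x \<and> P x} = (SIGMA x:{x \<in> X. P x}. {..<count B x})"
proof -
  have "k < count B x \<Longrightarrow> x \<in> X" for x k
    using assms count_eq_zero_iff[of B x] by (metis not_less0 subsetD)
  then show ?thesis by auto
qed

lemma finite_copies: "finite {(x, k). k < count B x}"
  using copies_eq_Sigma[of B "set_mset B" "\<lambda>_. True"] by simp

text \<open>The cardinality stands in for the rank: the rank counts the intervals that contain both
  i and j.\<close>

lemma card_interval_sum_image:
  assumes "finite A" "i \<in> I" "j \<in> I" "i \<le> j"
  shows "card (pmap (interval_sum I A :: ('k::field, _) persistence_module) i j `
      carrier (pspace (interval_sum I A :: ('k, _) persistence_module) i)) =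
    card (UNIV :: 'k set) ^ card {t \<in> A. fst (fst t) \<le> i \<and> enat j < snd (fst t)}"
proof -
  let ?N = "interval_sum I A :: ('k, _) persistence_module"
  let ?Q = "\<lambda>t. fst (fst t) \<le> i \<and> enat j < snd (fst t)"
  let ?R = "\<Pi>\<^sub>E t\<in>A. if ?Q t then UNIV else {0 :: 'k}"
  \<comment> \<open>Because i \<le> j, only the left endpoint matters at i and only the right
    endpoint at j.\<close>
  have Q: "i \<in> interval_support I (fst t) \<and> j \<in> interval_support I (fst t) \<longleftrightarrow> ?Q t" for t
    using assms(2-4) unfolding interval_support_def
    by (auto intro: le_less_trans[of "enat i" "enat j"])
  have "pmap ?N i j ` carrier (pspace ?N i) = ?R"
  proof (intro equalityI subsetI)
    fix y assume "y \<in> pmap ?N i j ` carrier (pspace ?N i)"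
    then show "y \<in> ?R" unfolding interval_sum_simps(4) Q by auto
  next
    fix y assume y: "y \<in> ?R"
    have y0: "y t = 0" if "t \<in> A" "\<not> ?Q t" for t
      using PiE_mem[OF y that(1)] that(2) by (auto split: if_splits)
    have "y \<in> carrier (pspace ?N i)" unfolding interval_sum_simps(1)[OF assms(1)]
    proof (rule PiE_I)
      fix t assume "t \<in> A"
      then show "y t \<in> (if i \<in> interval_support I (fst t) then UNIV else {0})"
        using y0[of t] Q[of t] by auto
    qed (use y in \<open>auto simp: PiE_def extensional_def\<close>)
    moreover have "pmap ?N i j y = y"
    proof
      fix t show "pmap ?N i j y t = y t"
        unfolding interval_sum_simps(4) Q using y0[of t] PiE_arb[OF y, of t] by auto
    qed
    ultimately show "y \<in> pmap ?N i j ` carrier (pspace ?N i)" by (metis image_eqI)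
  qed
  moreover have "card ?R = (\<Prod>t\<in>A. if ?Q t then card (UNIV :: 'k set) else 1)"
    unfolding card_PiE[OF assms(1)] by (intro prod.cong) auto
  moreover have "\<dots> = card (UNIV :: 'k set) ^ card {t \<in> A. ?Q t}"
    using assms(1) by (simp add: prod.If_cases Int_def)
  ultimately show ?thesis by simp
qed

text \<open>Persistence modules are records without laws; \<open>closed\<close> places the image
  inside the carrier on which \<phi> j is injective.\<close>

lemma persistence_iso_card_image:
  assumes iso: "persistence_iso M M'" and i: "i \<in> pindex M" and j: "j \<in> pindex M" and le: "i \<le> j"
    and closed: "pmap M i j ` carrier (pspace M i) \<subseteq> carrier (pspace M j)"
  shows "card (pmap M i j ` carrier (pspace M i)) = card (pmap M' i j ` carrier (pspace M' i))"
proof -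
  obtain \<phi> where bij: "\<And>j. j \<in> pindex M \<Longrightarrow> bij_betw (\<phi> j) (carrier (pspace M j)) (carrier (pspace M' j))"
    and comm: "\<And>x. x \<in> carrier (pspace M i) \<Longrightarrow> \<phi> j (pmap M i j x) = pmap M' i j (\<phi> i x)"
    using iso i j le unfolding persistence_iso_def by blast
  have "pmap M' i j ` carrier (pspace M' i) = pmap M' i j ` \<phi> i ` carrier (pspace M i)"
    using bij[OF i] unfolding bij_betw_def by simp
  also have "\<dots> = \<phi> j ` pmap M i j ` carrier (pspace M i)"
    unfolding image_image using comm by (intro image_cong) auto
  also have "card \<dots> = card (pmap M i j ` carrier (pspace M i))"
    using bij_betw_imp_inj_on[OF bij[OF j]] closed by (intro card_image) (rule inj_on_subset)
  finally show ?thesis by simp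
qed

lemma interval_multiset_eqI:
  assumes I: "finite I" and B: "set_mset B \<subseteq> interval_labels I" and B': "set_mset B' \<subseteq> interval_labels I"
    and rank: "\<And>i j. i \<in> I \<Longrightarrow> j \<in> I \<Longrightarrow> i \<le> j \<Longrightarrow>
      card {(x, k). k < count B x \<and> fst x \<le> i \<and> enat j < snd x} =
      card {(x, k). k < count B' x \<and> fst x \<le> i \<and> enat j < snd x}"
  shows "B = B'"
proof (rule ccontr)
  assume "B \<noteq> B'"
  define X where "X = set_mset B \<union> set_mset B'"
  define D where "D = {x. count B x \<noteq> count B' x}"
  have DX: "D \<subseteq> X"
  proof
    fix x assume "x \<in> D"
    then have "count B x \<noteq> 0 \<or> count B' x \<noteq> 0" unfolding D_def by (simp only: mem_Collect_eq) linarith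
    then show "x \<in> X" unfolding X_def by (simp only: Un_iff count_eq_zero_iff) blast
  qed
  have fin: "finite X" "finite D" unfolding X_def using finite_subset[OF DX] by (auto simp: X_def)
  have "D \<noteq> {}" using \<open>B \<noteq> B'\<close> unfolding D_def by (auto simp: multiset_eq_iff)
  txt \<open>Among the labels with different multiplicities take one, \<open>(b, d)\<close>, with \<open>b\<close> minimal and then
    \<open>d\<close> maximal. It is the only one contributing to the rank of the map from \<open>b\<close> to the predecessor
    \<open>j\<close> of \<open>d\<close> in \<open>I\<close>.\<close>
  define b where "b = Min (fst ` D)"
  have "b \<in> fst ` D" unfolding b_def using fin \<open>D \<noteq> {}\<close> by (intro Min_in) auto
  have b_le: "b \<le> fst x" if "x \<in> D" for x unfolding b_def using that fin by (intro Min_le) auto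
  define E where "E = {d. (b, d) \<in> D}"
  have E: "finite E" "E \<noteq> {}"
  proof -
    have "E \<subseteq> snd ` D" unfolding E_def by force
    then show "finite E" using fin finite_subset by blast
    show "E \<noteq> {}" using \<open>b \<in> fst ` D\<close> unfolding E_def by force
  qed
  define d where "d = Max E"
  have bd: "(b, d) \<in> D" using Max_in[OF E] unfolding d_def E_def by auto
  have "(b, d) \<in> interval_labels I" using bd DX B B' unfolding X_def by auto
  then have b: "b \<in> I" "enat b < d" unfolding interval_labels_def by auto
  \<comment> \<open>The set contains b, so the maximum exists; for infinite d it is the largest
    index.\<close>
  define j where "j = Max {j \<in> I. enat j < d}"
  have "j \<in> {j \<in> I. enat j < d}" unfolding j_def using b I by (intro Max_in) auto
  then have j: "j \<in> I" "enat j < d" by auto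
  have j_max: "e \<le> j" if "e \<in> I" "enat e < d" for e
    unfolding j_def using that I by (intro Max_ge) auto
  define P where "P x \<longleftrightarrow> fst x \<le> b \<and> enat j < snd x" for x :: "nat \<times> enat"
  have eq: "count B x = count B' x" if "x \<in> {x \<in> X. P x} - {(b, d)}" for x
  proof (rule ccontr)
    assume "count B x \<noteq> count B' x"
    then have x: "x \<in> D" "x \<in> X" unfolding D_def using that by auto
    then have fx: "fst x = b" using b_le[OF x(1)] that unfolding P_def by auto
    then have "snd x \<in> E" using x(1) unfolding E_def by (cases x) auto
    then have "snd x \<le> d" unfolding d_def using E by simp
    moreover have "snd x \<noteq> d" using fx that by (cases x) auto
    ultimately have lt: "snd x < d" by simp
    have "x \<in> interval_labels I" using x B B' unfolding X_def by auto
    \<comment> \<open>A right endpoint below d is finite and lies in I, hence it is at most j and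
      the label contributes nothing to this rank.\<close>
    then obtain e where "snd x = enat e" "e \<in> I" using lt unfolding interval_labels_def by auto
    then show False using j_max[of e] lt that unfolding P_def by auto
  qed
  have "P (b, d)" "(b, d) \<in> X" using j bd DX unfolding P_def by auto
  then have split: "(\<Sum>x\<in>{x \<in> X. P x}. count C x) = count C (b, d) + (\<Sum>x\<in>{x \<in> X. P x} - {(b, d)}. count C x)"
    for C using fin by (subst sum.remove[of _ "(b, d)"]) auto
  have cnt: "card {(x, k). k < count C x \<and> P x} = (\<Sum>x\<in>{x \<in> X. P x}. count C x)"
    if "set_mset C \<subseteq> X" for C
    using copies_eq_Sigma[OF that, of P] fin by (simp add: card_SigmaI)
  have "(\<Sum>x\<in>{x \<in> X. P x}. count B x) = (\<Sum>x\<in>{x \<in> X. P x}. count B' x)"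
    using rank[OF b(1) j(1) j_max[OF b]] cnt[of B] cnt[of B'] unfolding P_def X_def by simp
  then have "count B (b, d) = count B' (b, d)"
    unfolding split using eq by (simp add: sum.cong[OF refl eq])
  then show False using bd unfolding D_def by simp
qed

lemma decomposes_into_unique:
  fixes M :: "('k::field, 'v) persistence_module"
  assumes k: "finite (UNIV :: 'k set)" and I: "finite (pindex M)"
    and closed: "\<And>i j. i \<in> pindex M \<Longrightarrow> j \<in> pindex M \<Longrightarrow> i \<le> j \<Longrightarrow>
      pmap M i j ` carrier (pspace M i) \<subseteq> carrier (pspace M j)"
    and B: "decomposes_into M B" and B': "decomposes_into M B'"
  shows "B = B'"
proof (rule interval_multiset_eqI[OF I])
  fix i j assume ij: "i \<in> pindex M" "j \<in> pindex M" "i \<le> j"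
  have "card (pmap M i j ` carrier (pspace M i)) =
      card (UNIV :: 'k set) ^ card {(x, k). k < count C x \<and> fst x \<le> i \<and> enat j < snd x}"
    if "decomposes_into M C" for C
  proof -
    have "{t \<in> {(x, k). k < count C x}. fst (fst t) \<le> i \<and> enat j < snd (fst t)} =
        {(x, k). k < count C x \<and> fst x \<le> i \<and> enat j < snd x}" by auto
    then show ?thesis
      using persistence_iso_card_image[OF that[unfolded decomposes_into_iff, THEN conjunct2] ij closed[OF ij]]
        card_interval_sum_image[OF finite_copies[of C] ij, where 'k = 'k]
      by simp
  qed
  note rank = this[OF B] this[OF B']
  \<comment> \<open>A base greater than 1 allows the exponents to be compared.\<close>
  have "1 < card (UNIV :: 'k set)"
    using card_mono[OF k subset_UNIV, of "{0 :: 'k, 1}"] by simp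
  then show "card {(x, k). k < count B x \<and> fst x \<le> i \<and> enat j < snd x} =
      card {(x, k). k < count B' x \<and> fst x \<le> i \<and> enat j < snd x}"
    using rank by (simp add: power_inject_exp)
qed (use B B' in \<open>auto simp: decomposes_into_iff\<close>)

section \<open>The interval decomposition given by a paired basis\<close>

context filtered_complex
begin

lemma coord_beyond_support:
  assumes z: "triangular N z" and c: "chain m h c" "m \<le> N" and i: "i \<in> {1..N}" "m < i"
  shows "coord z i c = 0"
proof -
  obtain a where "c = (\<lambda>\<tau>. \<Sum>k\<in>{1..m}. a k * z k \<tau>)"
    using triangular_expand[OF c(2) triangular_mono[OF z c(2)] c(1)] by blast
  then have "coord z i c = (\<Sum>k\<in>{1..m}. a k * coord z i (z k))" by (simp only: coord_comb)
  also have "\<dots> = 0" using i c(2) by (intro sum.neutral) (auto simp: coord_basis[OF z])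
  finally show ?thesis .
qed

text \<open>For positive i, injectivity of q makes the least preimage the only one, as
  \<open>death_eq\<close> shows.\<close>

definition death :: "(nat \<Rightarrow> nat) \<Rightarrow> nat \<Rightarrow> enat" where
  "death q i = (if i \<in> q ` {1..N} then enat (LEAST k. k \<in> {1..N} \<and> q k = i) else \<infinity>)"

lemma death_eq:
  assumes "paired_basis N z q" "k \<in> {1..N}" "q k \<noteq> 0"
  shows "death q (q k) = enat k"
proof -
  have "(LEAST l. l \<in> {1..N} \<and> q l = q k) = k"
  proof (rule Least_equality)
    fix l assume l: "l \<in> {1..N} \<and> q l = q k"
    have "inj_on q {k \<in> {1..N}. q k \<noteq> 0}" using assms(1) unfolding paired_basis_def by blast
    then have "l = k" by (rule inj_onD) (use l assms(2,3) in simp_all)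
    then show "k \<le> l" by simp
  qed (use assms(2) in simp)
  then show ?thesis unfolding death_def using assms(2) by simp
qed

text \<open>The partner k of i removes i from the active indices from frame k onwards. This turns a
  condition on one frame into membership of j in an interval.\<close>

lemma active_iff:
  assumes B: "paired_basis N z q" and j: "j \<le> N" and i: "i \<in> {1..N}" "q i = 0"
  shows "i \<in> active q j \<longleftrightarrow> i \<le> j \<and> enat j < death q i"
proof (cases "i \<in> q ` {1..N}")
  case True
  then obtain k where k: "k \<in> {1..N}" "i = q k" by blast
  have "i \<in> q ` {1..j} \<longleftrightarrow> k \<le> j"
  proof
    assume "i \<in> q ` {1..j}"
    then obtain l where l: "l \<in> {1..j}" "i = q l" by blast
    have "death q (q l) = enat l" using l i(1) j by (intro death_eq[OF B]) auto
    moreover have "death q (q k) = enat k" using k i(1) by (intro death_eq[OF B]) auto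
    ultimately have "enat l = enat k" using k(2) l(2) by metis
    then show "k \<le> j" using l by simp
  qed (use k(1) in \<open>simp add: k(2)\<close>)
  moreover have "death q i = enat k"
    unfolding k(2) by (rule death_eq[OF B k(1)]) (use k(2) i(1) in simp)
  ultimately show ?thesis using i unfolding active_def by auto
next
  case False
  then have "i \<notin> q ` {1..j}" using j by auto
  then show ?thesis using False i unfolding active_def death_def by auto
qed

end

section \<open>Total homology of the frames and its coordinates\<close>

context simplexwise_filtration
begin

lemma boundaries_frame_mono:
  assumes "i \<le> j" "j \<le> N"
  shows "boundaries (frame i) p \<subseteq> boundaries (frame j) p"
proof -
  have "i \<le> N" using assms by simp
  then show ?thesis
    unfolding boundaries_frame[OF \<open>i \<le> N\<close>] boundaries_frame[OF assms(2)]
    using chain_mono[OF _ assms(1)] by blast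
qed

lemma cycles_frame_mono:
  assumes "i \<le> j" "j \<le> N"
  shows "cycles (frame i) p \<subseteq> cycles (frame j) p"
proof -
  have "i \<le> N" using assms by simp
  then show ?thesis
    unfolding cycles_frame[OF \<open>i \<le> N\<close>] cycles_frame[OF assms(2)]
    using chain_mono[OF _ assms(1)] by blast
qed

definition total_class :: "nat \<Rightarrow> (nat \<Rightarrow> 'a set \<Rightarrow> bit) \<Rightarrow> nat \<Rightarrow> ('a set \<Rightarrow> bit) set" where
  "total_class j c = (\<lambda>p. homology_class (frame j) p (c p))"

definition finite_cycles :: "nat \<Rightarrow> (nat \<Rightarrow> 'a set \<Rightarrow> bit) set" where
  "finite_cycles j = {c. \<forall>p. c p \<in> cycles (frame j) p}"

text \<open>The finite support demanded by the direct sum is automatic: a frame has simplices in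
  finitely many dimensions, and all other cycles vanish.\<close>

lemma filtration_homology_simps:
  assumes "j \<le> N"
  shows "carrier (pspace (filtration_homology I frame) j) = total_class j ` finite_cycles j"
proof -
  have zero: "homology_class (frame j) p (c p) = \<zero>\<^bsub>homology_module (frame j) p\<^esub>"
    if c: "c \<in> finite_cycles j" and p: "p \<notin> (\<lambda>\<tau>. card \<tau> - 1) ` frame j" for c p
  proof -
    have "chain j p (c p)" using c assms unfolding finite_cycles_def by (auto simp: cycles_frame)
    then have "c p = (\<lambda>_. 0)" using p unfolding chain_def frame_def by fast
    then show ?thesis by (simp add: zero_homology_module)
  qed
  have fin: "finite {p. homology_class (frame j) p (c p) \<noteq> \<zero>\<^bsub>homology_module (frame j) p\<^esub>}"
    if "c \<in> finite_cycles j" for c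
  proof (rule finite_subset)
    show "{p. homology_class (frame j) p (c p) \<noteq> \<zero>\<^bsub>homology_module (frame j) p\<^esub>} \<subseteq> (\<lambda>\<tau>. card \<tau> - 1) ` frame j"
      using zero[OF that] by blast
    show "finite ((\<lambda>\<tau>. card \<tau> - 1) ` frame j)" unfolding frame_def by simp
  qed
  have "carrier (pspace (filtration_homology I frame) j) =
      {X. (\<forall>p. X p \<in> homology_class (frame j) p ` cycles (frame j) p) \<and>
          finite {p. X p \<noteq> \<zero>\<^bsub>homology_module (frame j) p\<^esub>}}"
    unfolding filtration_homology_def persistence_sum_def direct_sum_module_def
    by (auto simp: carrier_homology_module)
  also have "\<dots> = total_class j ` finite_cycles j"
  proof (intro equalityI subsetI)
    fix X assume X: "X \<in> {X. (\<forall>p. X p \<in> homology_class (frame j) p ` cycles (frame j) p) \<and>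
          finite {p. X p \<noteq> \<zero>\<^bsub>homology_module (frame j) p\<^esub>}}"
    then have "\<forall>p. \<exists>c. c \<in> cycles (frame j) p \<and> X p = homology_class (frame j) p c" by blast
    then obtain c where "\<forall>p. c p \<in> cycles (frame j) p \<and> X p = homology_class (frame j) p (c p)" by metis
    then show "X \<in> total_class j ` finite_cycles j"
      unfolding total_class_def finite_cycles_def by (intro image_eqI[of _ _ c]) auto
  next
    fix X assume "X \<in> total_class j ` finite_cycles j"
    then obtain c where "c \<in> finite_cycles j" "X = total_class j c" by blast
    then show "X \<in> {X. (\<forall>p. X p \<in> homology_class (frame j) p ` cycles (frame j) p) \<and>
          finite {p. X p \<noteq> \<zero>\<^bsub>homology_module (frame j) p\<^esub>}}"
      using fin unfolding total_class_def finite_cycles_def by auto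
  qed
  finally show ?thesis .
qed

lemma add_filtration_homology:
  "total_class j c \<oplus>\<^bsub>pspace (filtration_homology I frame) j\<^esub> total_class j c' =
    total_class j (\<lambda>p \<rho>. c p \<rho> + c' p \<rho>)"
  unfolding filtration_homology_def persistence_sum_def direct_sum_module_def total_class_def
  by (simp only: persistence_module.simps module.simps ring.simps add_homology_module restrict_UNIV)

lemma smult_filtration_homology:
  "a \<odot>\<^bsub>pspace (filtration_homology I frame) j\<^esub> total_class j c = total_class j (\<lambda>p \<rho>. a * c p \<rho>)"
  unfolding filtration_homology_def persistence_sum_def direct_sum_module_def total_class_def
  by (simp only: persistence_module.simps module.simps smult_homology_module restrict_UNIV)

lemma pmap_filtration_homology:
  assumes "i \<le> j" "j \<le> N"
  shows "pmap (filtration_homology I frame) i j (total_class i c) = total_class j c"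
  unfolding filtration_homology_def persistence_sum_def total_class_def
  by (simp add: homology_map_class[OF boundaries_frame_mono[OF assms]] restrict_UNIV)

lemma pmap_filtration_homology_closed:
  assumes "i \<le> j" "j \<le> N"
  shows "pmap (filtration_homology I frame) i j ` carrier (pspace (filtration_homology I frame) i)
    \<subseteq> carrier (pspace (filtration_homology I frame) j)"
proof -
  have "i \<le> N" using assms by simp
  have "finite_cycles i \<subseteq> finite_cycles j"
    unfolding finite_cycles_def using cycles_frame_mono[OF assms] by blast
  then show ?thesis
    unfolding filtration_homology_simps[OF \<open>i \<le> N\<close>] filtration_homology_simps[OF assms(2)]
      image_image pmap_filtration_homology[OF assms] by (rule image_mono)
qed

lemma pindex_filtration_homology: "pindex (filtration_homology I F) = I"
  unfolding filtration_homology_def persistence_sum_def by simp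

text \<open>The coordinate is read off an arbitrary representative in the dimension of the i-th
  simplex; by \<open>coord_boundary\<close> the choice does not affect active coordinates.\<close>

definition class_coord :: "(nat \<Rightarrow> 'a set \<Rightarrow> bit) \<Rightarrow> (nat \<Rightarrow> nat) \<Rightarrow> nat \<Rightarrow>
    (nat \<Rightarrow> ('a set \<Rightarrow> bit) set) \<Rightarrow> nat \<Rightarrow> bit" where
  "class_coord z q j X i =
     (if i \<in> active q j then coord z i (SOME c. c \<in> X (card (\<sigma> i) - 1)) else 0)"

lemma class_coord_total_class:
  assumes B: "paired_basis N z q" and j: "j \<le> N"
  shows "class_coord z q j (total_class j c) i =
    (if i \<in> active q j then coord z i (c (card (\<sigma> i) - 1)) else 0)"
proof (cases "i \<in> active q j")
  case True
  define p where "p = card (\<sigma> i) - 1"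
  define c' where "c' = (SOME c'. c' \<in> homology_class (frame j) p (c p))"
  have "c' \<in> homology_class (frame j) p (c p)"
    unfolding c'_def
    by (rule someI[of "\<lambda>c'. c' \<in> homology_class (frame j) p (c p)" "c p"]) (rule homology_class_self)
  then have "(\<lambda>\<rho>. c p \<rho> + c' \<rho>) \<in> boundaries (frame j) p" by (rule homology_class_diff)
  then obtain b where b: "chain j (Suc p) b" "(\<lambda>\<rho>. c p \<rho> + c' \<rho>) = bd b"
    unfolding boundaries_frame[OF j] by blast
  have "coord z i (c p) + coord z i c' = 0"
    unfolding coord_add[symmetric] b(2) by (rule coord_boundary[OF B j True b(1)])
  then have "coord z i (c p) + coord z i c' + coord z i c' = 0 + coord z i c'" by (rule arg_cong)
  then have "coord z i c' = coord z i (c p)" unfolding bit_add_cancel(1) add_0_left by (rule sym)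
  then show ?thesis using True unfolding class_coord_def total_class_def c'_def p_def by simp
qed (simp add: class_coord_def)

text \<open>This yields injectivity of the coordinate map: the sum of the two cycles has no active
  coordinates and so bounds.\<close>

lemma total_class_eqI:
  assumes B: "paired_basis N z q" and j: "j \<le> N"
    and c: "c \<in> finite_cycles j" and c': "c' \<in> finite_cycles j"
    and eq: "\<And>i. i \<in> active q j \<Longrightarrow>
      coord z i (c (card (\<sigma> i) - 1)) = coord z i (c' (card (\<sigma> i) - 1))"
  shows "total_class j c = total_class j c'"
  unfolding total_class_def
proof (rule ext, rule homology_class_eqI)
  fix p
  have cyc: "chain j p (c p)" "bd (c p) = (\<lambda>_. 0)" "chain j p (c' p)" "bd (c' p) = (\<lambda>_. 0)"
    using c c' j unfolding finite_cycles_def by (auto simp: cycles_frame)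
  have "\<exists>b. chain j (Suc p) b \<and> bd b = (\<lambda>\<rho>. c p \<rho> + c' p \<rho>)"
  proof (rule coord_zero_imp_boundary[OF B j])
    show "chain j p (\<lambda>\<rho>. c p \<rho> + c' p \<rho>)" using cyc by (intro chain_add)
    show "bd (\<lambda>\<rho>. c p \<rho> + c' p \<rho>) = (\<lambda>_. 0)" unfolding bd_add cyc add_0_right ..
    fix i assume "i \<in> active q j" "card (\<sigma> i) - 1 = p"
    then show "coord z i (\<lambda>\<rho>. c p \<rho> + c' p \<rho>) = 0" using eq[of i] by (simp only: coord_add bit_add_self)
  qed
  then obtain b where "chain j (Suc p) b" "bd b = (\<lambda>\<rho>. c p \<rho> + c' p \<rho>)" by blast
  then show "(\<lambda>\<rho>. c p \<rho> + c' p \<rho>) \<in> boundaries (frame j) p"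
    unfolding boundaries_frame[OF j] by (intro image_eqI[of _ _ b]) simp_all
qed

text \<open>This yields surjectivity: take the combination of active cycles with the prescribed
  coefficients and split it by dimension.\<close>

lemma finite_cycles_with_coords:
  assumes B: "paired_basis N z q" and j: "j \<le> N"
  shows "\<exists>c\<in>finite_cycles j. \<forall>i\<in>active q j. coord z i (c (card (\<sigma> i) - 1)) = x i"
proof -
  define A where "A p = {k \<in> active q j. card (\<sigma> k) - 1 = p}" for p
  have tri: "triangular N z" using B unfolding paired_basis_def by blast
  define c where "c p = (\<lambda>\<tau>. \<Sum>k\<in>A p. x k * z k \<tau>)" for p
  have "c \<in> finite_cycles j" unfolding finite_cycles_def cycles_frame[OF j] mem_Collect_eq
  proof (intro allI conjI)
    fix p
    show "chain j p (c p)" unfolding c_def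
      using active_chain(1)[OF B j] by (intro chain_comb) (auto simp: A_def)
    have "a * bd (z k) \<tau> = 0" if "k \<in> A p" for a k \<tau>
      using active_chain(2)[OF B j, of k] that unfolding A_def by simp
    then show "bd (c p) = (\<lambda>_. 0)" unfolding c_def bd_comb by (simp only: sum.neutral_const cong: sum.cong)
  qed
  moreover have "coord z i (c (card (\<sigma> i) - 1)) = x i" if i: "i \<in> active q j" for i
  proof -
    have sub: "active q j \<subseteq> {1..N}" using j unfolding active_def by auto
    have fin: "finite (A p)" for p unfolding A_def active_def by simp
    have "coord z i (c (card (\<sigma> i) - 1)) = (\<Sum>k\<in>A (card (\<sigma> i) - 1). x k * coord z i (z k))"
      unfolding c_def by (rule coord_comb)
    also have "\<dots> = (\<Sum>k\<in>A (card (\<sigma> i) - 1). if k = i then x k else 0)"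
    proof (rule sum.cong[OF refl])
      fix k assume "k \<in> A (card (\<sigma> i) - 1)"
      then have "k \<in> {1..N}" "i \<in> {1..N}" using sub i unfolding A_def by auto
      then show "x k * coord z i (z k) = (if k = i then x k else 0)"
        by (simp add: coord_basis[OF tri] del: One_nat_def)
    qed
    also have "\<dots> = x i" using fin i by (subst sum.delta) (simp_all add: A_def)
    finally show ?thesis .
  qed
  ultimately show ?thesis by blast
qed

text \<open>Active coordinates give the isomorphism. P holds the cycles whose intervals are kept;
  \<open>rest\<close> says that the discarded ones are active at no index of I, so no coordinate is
  lost.\<close>

lemma decomposes_into_filtration_homology:
  assumes B: "paired_basis N z q" and I: "I \<subseteq> {0..N}"
    and P: "P \<subseteq> {i \<in> {1..N}. q i = 0}"
    and labels: "\<And>i. i \<in> P \<Longrightarrow> (i, death q i) \<in> interval_labels I"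
    and rest: "\<And>i j. i \<in> {1..N} \<Longrightarrow> q i = 0 \<Longrightarrow> i \<notin> P \<Longrightarrow> j \<in> I \<Longrightarrow> i \<notin> active q j"
  shows "decomposes_into (filtration_homology I frame) (image_mset (\<lambda>i. (i, death q i)) (mset_set P))"
proof -
  define lab where "lab i = (i, death q i)" for i
  define A where "A = {(x, k :: nat). k < count (image_mset lab (mset_set P)) x}"
  let ?M = "filtration_homology I frame"
  let ?S = "interval_sum I A :: (bit, _) persistence_module"
  have tri: "triangular N z" using B unfolding paired_basis_def by blast
  have finP: "finite P" by (rule finite_subset[OF P]) simp
  \<comment> \<open>Labels differ in their left endpoints, so multiplicities are at most one and the
    only copy number is 0.\<close>
  have inj: "inj_on lab P" unfolding lab_def by (auto simp: inj_on_def)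
  have "image_mset lab (mset_set P) = mset_set (lab ` P)" using inj by (rule image_mset_mset_set)
  then have "A = {(x, k). k < (if x \<in> lab ` P then 1 else 0)}"
    unfolding A_def using finP by (simp add: count_mset_set')
  then have A: "A = (\<lambda>i. (lab i, 0)) ` P" by (auto split: if_splits)
  have finA: "finite A" unfolding A using finP by simp
  have supp: "j \<in> interval_support I (fst t) \<longleftrightarrow> fst (fst t) \<in> active q j" if t: "t \<in> A" and j: "j \<in> I" for t j
  proof -
    obtain i where i: "i \<in> P" "t = (lab i, 0)" using t A by auto
    have "i \<in> {1..N}" "q i = 0" "j \<le> N" using i P j I by auto
    from active_iff[OF B this(3) this(1,2)] show ?thesis
      using j i unfolding interval_support_def lab_def by auto
  qed
  have act: "(lab i, 0) \<in> A" if "i \<in> active q j" "j \<in> I" for i j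
  proof -
    have "i \<in> {1..N}" "q i = 0" using that I unfolding active_def by auto
    then have "i \<in> P" using rest that by blast
    then show ?thesis unfolding A by blast
  qed
  have jN: "j \<le> N" if "j \<in> I" for j using that I by auto
  define \<phi> where "\<phi> j X = (\<lambda>t\<in>A. class_coord z q j X (fst (fst t)))" for j X
  have \<phi>: "\<phi> j (total_class j c) =
      (\<lambda>t\<in>A. if fst (fst t) \<in> active q j then coord z (fst (fst t)) (c (card (\<sigma> (fst (fst t))) - 1)) else 0)"
    if "j \<in> I" for j c
    unfolding \<phi>_def class_coord_total_class[OF B jN[OF that]] ..
  have carS: "carrier (pspace ?S j) = (\<Pi>\<^sub>E t\<in>A. if fst (fst t) \<in> active q j then UNIV else {0})" if "j \<in> I" for j
    unfolding interval_sum_simps(1)[OF finA] using supp that by (intro PiE_cong) auto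
  have "persistence_iso ?M ?S"
    unfolding persistence_iso_def pindex_filtration_homology interval_sum_simps(5)
  proof (intro conjI refl exI[of _ \<phi>] ballI impI)
    fix j assume j: "j \<in> I"
    note carM = filtration_homology_simps[OF jN[OF j], of I]
    have closed: "\<phi> j (total_class j c) \<in> carrier (pspace ?S j)" for c
      unfolding carS[OF j] \<phi>[OF j] by auto
    show "\<phi> j \<in> LinearCombinations.module_hom class_ring (pspace ?M j) (pspace ?S j)"
      unfolding LinearCombinations.module_hom_def mem_Collect_eq
    proof (intro conjI ballI allI impI)
      show "\<phi> j \<in> carrier (pspace ?M j) \<rightarrow> carrier (pspace ?S j)"
        unfolding carM using closed by blast
    next
      fix X Y assume "X \<in> carrier (pspace ?M j) \<and> Y \<in> carrier (pspace ?M j)"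
      then obtain c c' where XY: "X = total_class j c" "Y = total_class j c'" unfolding carM by blast
      show "\<phi> j (X \<oplus>\<^bsub>pspace ?M j\<^esub> Y) = \<phi> j X \<oplus>\<^bsub>pspace ?S j\<^esub> \<phi> j Y"
        unfolding XY interval_sum_simps(2) add_filtration_homology \<phi>[OF j]
      proof (rule restrict_ext, goal_cases)
        case (1 t)
        show ?case unfolding restrict_apply'[OF 1]
          by (cases "fst (fst t) \<in> active q j") (simp_all only: coord_add if_True if_False add_0_right simp_thms)
      qed
    next
      fix a :: bit and X assume "a \<in> carrier class_ring \<and> X \<in> carrier (pspace ?M j)"
      then obtain c where X: "X = total_class j c" unfolding carM by blast
      show "\<phi> j (a \<odot>\<^bsub>pspace ?M j\<^esub> X) = a \<odot>\<^bsub>pspace ?S j\<^esub> \<phi> j X"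
        unfolding X interval_sum_simps(3) smult_filtration_homology \<phi>[OF j]
      proof (rule restrict_ext, goal_cases)
        case (1 t)
        show ?case unfolding restrict_apply'[OF 1]
          by (cases "fst (fst t) \<in> active q j") (simp_all only: coord_scale if_True if_False mult_zero_right simp_thms)
      qed
    qed
    show "bij_betw (\<phi> j) (carrier (pspace ?M j)) (carrier (pspace ?S j))"
      unfolding bij_betw_def
    proof (intro conjI inj_onI)
      fix X Y assume X: "X \<in> carrier (pspace ?M j)" and Y: "Y \<in> carrier (pspace ?M j)" and eq: "\<phi> j X = \<phi> j Y"
      obtain c c' where c: "c \<in> finite_cycles j" "X = total_class j c" and c': "c' \<in> finite_cycles j" "Y = total_class j c'"
        using X Y unfolding carM by blast
      show "X = Y" unfolding c(2) c'(2)
      proof (rule total_class_eqI[OF B jN[OF j] c(1) c'(1)])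
        fix i assume i: "i \<in> active q j"
        have "\<phi> j X (lab i, 0) = \<phi> j Y (lab i, 0)" using eq by simp
        then show "coord z i (c (card (\<sigma> i) - 1)) = coord z i (c' (card (\<sigma> i) - 1))"
          unfolding c(2) c'(2) \<phi>[OF j] using i act[OF i j] by (simp add: lab_def)
      qed
    next
      show "\<phi> j ` carrier (pspace ?M j) = carrier (pspace ?S j)"
      proof (intro equalityI subsetI)
        fix x assume "x \<in> \<phi> j ` carrier (pspace ?M j)"
        then show "x \<in> carrier (pspace ?S j)" unfolding carM using closed by blast
      next
        fix x assume x: "x \<in> carrier (pspace ?S j)"
        obtain c where c: "c \<in> finite_cycles j"
          and ci: "\<And>i. i \<in> active q j \<Longrightarrow> coord z i (c (card (\<sigma> i) - 1)) = x (lab i, 0)"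
          using finite_cycles_with_coords[OF B jN[OF j], of "\<lambda>i. x (lab i, 0)"] by blast
        have "\<phi> j (total_class j c) t = x t" for t
        proof (cases "t \<in> A")
          case True
          then have t: "t = (lab (fst (fst t)), 0)" using A unfolding lab_def by auto
          show ?thesis
          proof (cases "fst (fst t) \<in> active q j")
            case act: True
            then show ?thesis using True ci[OF act] t unfolding \<phi>[OF j] by simp
          next
            case False
            then show ?thesis using True x[unfolded carS[OF j], THEN PiE_mem, OF True] unfolding \<phi>[OF j] by simp
          qed
        next
          case False
          then show ?thesis using x[unfolded carS[OF j], THEN PiE_arb, OF False] unfolding \<phi>[OF j] by simp
        qed
        then have "x = \<phi> j (total_class j c)" by auto
        then show "x \<in> \<phi> j ` carrier (pspace ?M j)" unfolding carM using c by blast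
      qed
    qed
  next
    fix i j X assume ij: "i \<in> I" "j \<in> I" "i \<le> j" and X: "X \<in> carrier (pspace ?M i)"
    obtain c where c: "c \<in> finite_cycles i" "X = total_class i c"
      using X unfolding filtration_homology_simps[OF jN[OF ij(1)]] by blast
    show "\<phi> j (pmap ?M i j X) = pmap ?S i j (\<phi> i X)"
      unfolding c(2) pmap_filtration_homology[OF ij(3) jN[OF ij(2)]] \<phi>[OF ij(1)] \<phi>[OF ij(2)] interval_sum_simps(4)
    proof (rule restrict_ext)
      fix t assume t: "t \<in> A"
      define k where "k = fst (fst t)"
      have kN: "k \<in> {1..N}" "q k = 0" using t P A unfolding k_def lab_def by auto
      \<comment> \<open>The one case in which the two sides could differ: an index born after frame
        i. A cycle of frame i has coordinate 0 there.\<close>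
      have "coord z k (c (card (\<sigma> k) - 1)) = 0" if "k \<in> active q j" "k \<notin> active q i"
      proof -
        have "enat i \<le> enat j" using ij(3) by simp
        also have "\<dots> < death q k" using that(1) active_iff[OF B jN[OF ij(2)] kN] by blast
        finally have "i < k" using that(2) active_iff[OF B jN[OF ij(1)] kN] by auto
        moreover have "chain i (card (\<sigma> k) - 1) (c (card (\<sigma> k) - 1))"
          using c(1) jN[OF ij(1)] unfolding finite_cycles_def by (auto simp: cycles_frame)
        ultimately show ?thesis using coord_beyond_support[OF tri _ jN[OF ij(1)] kN(1)] by blast
      qed
      then show "(if fst (fst t) \<in> active q j then coord z (fst (fst t)) (c (card (\<sigma> (fst (fst t))) - 1)) else 0) =
          (if i \<in> interval_support I (fst t) \<and> j \<in> interval_support I (fst t)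
           then (\<lambda>t\<in>A. if fst (fst t) \<in> active q i then coord z (fst (fst t)) (c (card (\<sigma> (fst (fst t))) - 1)) else 0) t
           else 0)"
        unfolding supp[OF t ij(1)] supp[OF t ij(2)] restrict_apply'[OF t] k_def[symmetric]
        by (cases "k \<in> active q i"; cases "k \<in> active q j") simp_all
    qed
  qed
  moreover have "set_mset (image_mset lab (mset_set P)) \<subseteq> interval_labels I"
    using labels finP unfolding lab_def by auto
  ultimately show ?thesis
    unfolding decomposes_into_iff pindex_filtration_homology A_def lab_def by blast
qed

end

section \<open>Colex arrows\<close>

text \<open>The facts in \<open>folding_insort_key\<close> concern the constants of the
  \<open>linorder\<close> locale. This and the next lemma identify them with the overloaded ones, as
  required by the rewriting interpretation below.\<close>

lemma insort_key_linorder: "linorder.insort_key (\<le>) f x xs = insort_key (f :: 'a \<Rightarrow> 'b::linorder) x xs"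
  by (induction xs) (simp_all add: linorder.insort_key.simps[OF linorder_axioms])

lemma sorted_key_list_of_set_linorder:
  "linorder.sorted_key_list_of_set (\<le>) f = sorted_key_list_of_set (f :: 'a \<Rightarrow> 'b::linorder)"
proof -
  have "linorder.insort_key (\<le>) f = insort_key f" by (intro ext insort_key_linorder)
  then show ?thesis
    unfolding sorted_key_list_of_set_def linorder.sorted_key_list_of_set_def[OF linorder_axioms] by simp
qed

text \<open>Compare from the largest vertices down. At the first disagreement the vertex of the face
  also occurs in the coface; if it were the larger one, it would occur in the part already compared
  and so appear twice in the face. Without disagreement the face is a proper suffix.\<close>

lemma not_colex_less_subset:
  assumes f: "inj_on f \<beta>" and fin: "finite \<beta>" and sub: "\<alpha> \<subset> \<beta>" and ne: "\<alpha> \<noteq> {}"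
  shows "\<not> colex_less f \<beta> \<alpha>"
proof -
  interpret folding_insort_key "(\<le>)" "(<)" \<beta> f
    rewrites "linorder.sorted_key_list_of_set (\<le>) f = sorted_key_list_of_set f"
    by unfold_locales (rule f, rule sorted_key_list_of_set_linorder)
  define a where "a = sorted_key_list_of_set f \<alpha>"
  define b where "b = sorted_key_list_of_set f \<beta>"
  have fin\<alpha>: "finite \<alpha>" using sub fin finite_subset by blast
  have a: "set a = \<alpha>" "length a = card \<alpha>" "sorted_wrt (<) (map f a)"
    unfolding a_def using psubset_imp_subset[OF sub] fin\<alpha> by simp_all
  have b: "set b = \<beta>" "length b = card \<beta>" "sorted_wrt (<) (map f b)"
    unfolding b_def using fin by simp_all
  have lt: "0 < length a" "length a < length b"
    using a(2) b(2) psubset_card_mono[OF fin sub] ne fin\<alpha> by (auto simp: card_gt_0_iff)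
  define k where "k = length a - 1"
  define l where "l = length b - 1"
  have kl: "k < l" "k < length a" "l < length b" using lt unfolding k_def l_def by linarith+
  define differ where "differ i \<longleftrightarrow> i \<le> min l k \<and> b ! (l - i) \<noteq> a ! (k - i)" for i
  have less_nth: "x < y" if "f (c ! x) < f (c ! y)" "sorted_wrt (<) (map f c)" "x < length c" "y < length c"
    for x y and c :: "'a list"
  proof (rule ccontr)
    assume "\<not> x < y"
    then have "f (c ! y) \<le> f (c ! x)"
      using sorted_wrt_nth_less[OF that(2), of y x] that(3,4) by (cases "x = y") auto
    then show False using that(1) by simp
  qed
  have "\<not> colex_word_less f b a"
  proof (cases "\<exists>i. differ i")
    case True
    define m where "m = (LEAST i. differ i)"
    have m: "differ m" unfolding m_def using True by (rule LeastI_ex)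
    then have mk: "m \<le> k" unfolding differ_def by auto
    have agree: "b ! (l - i) = a ! (k - i)" if "i < m" for i
    proof -
      have "\<not> differ i" using that not_less_Least[of i differ] unfolding m_def by blast
      then show ?thesis using that mk kl unfolding differ_def by auto
    qed
    have "\<not> f (b ! (l - m)) < f (a ! (k - m))"
    proof
      assume less: "f (b ! (l - m)) < f (a ! (k - m))"
      have "a ! (k - m) \<in> set b" using a(1) b(1) sub kl nth_mem[of "k - m" a] by auto
      then obtain r where r: "r < length b" "b ! r = a ! (k - m)" by (auto simp: in_set_conv_nth)
      have "l - m < r" using less_nth[OF _ b(3), of "l - m" r] less r kl by auto
      \<comment> \<open>The place, counted from the end, at which the coface has the disputed
        vertex.\<close>
      define i where "i = l - r"
      have i: "i < m" "r = l - i" using r(1) \<open>l - m < r\<close> mk kl unfolding i_def l_def by auto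
      have "a ! (k - i) = a ! (k - m)" using agree[OF i(1)] r(2) i(2) by simp
      moreover have "f (a ! (k - m)) < f (a ! (k - i))"
        using sorted_wrt_nth_less[OF a(3), of "k - m" "k - i"] i(1) mk kl by auto
      ultimately show False by simp
    qed
    then show ?thesis
      using True unfolding colex_word_less_def Let_def k_def[symmetric] l_def[symmetric]
        differ_def[symmetric] m_def[symmetric] by simp
  next
    case False
    then show ?thesis
      using kl unfolding colex_word_less_def Let_def k_def[symmetric] l_def[symmetric]
        differ_def[symmetric] by simp
  qed
  then show ?thesis unfolding colex_less_def a_def b_def .
qed

section \<open>Comparison of the two filtrations\<close>

lemma (in simplexwise_filtration) interval_decomposition_filtration_homology:
  assumes I: "I \<subseteq> {0..N}" and B: "decomposes_into (filtration_homology I frame) B"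
  shows "interval_decomposition (filtration_homology I frame) = B"
  unfolding interval_decomposition_def
proof (rule the_equality)
  show "decomposes_into (filtration_homology I frame) B" by (rule B)
  fix B' assume B': "decomposes_into (filtration_homology I frame) B'"
  show "B' = B"
  proof (rule decomposes_into_unique[OF _ _ _ B' B])
    have "(UNIV :: bit set) \<subseteq> {0, 1}" by auto
    then show "finite (UNIV :: bit set)" by (rule finite_subset) simp
    show "finite (pindex (filtration_homology I frame))"
      unfolding pindex_filtration_homology using I by (rule finite_subset) simp
    show "pmap (filtration_homology I frame) i j ` carrier (pspace (filtration_homology I frame) i)
        \<subseteq> carrier (pspace (filtration_homology I frame) j)"
      if "j \<in> pindex (filtration_homology I frame)" "i \<le> j" for i j
      using that I unfolding pindex_filtration_homology
      by (intro pmap_filtration_homology_closed) auto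
  qed
qed

theorem theorem3p9:
  fixes V :: "'a set" and K :: "'a set set" and f :: "'a \<Rightarrow> nat"
    and n N :: nat and \<sigma> :: "nat \<Rightarrow> 'a set" and Kf :: "nat \<Rightarrow> 'a set set" and T J :: "nat set"
  assumes K: "finite V" "simplicial_complex V K"
    and n: "card V = n"
    and f: "bij_betw f V {1..n}"
    and N: "N = card K"
    and enum: "bij_betw \<sigma> {1..N} K"
    and colex: "\<And>i j. 1 \<le> i \<Longrightarrow> i < j \<Longrightarrow> j \<le> N \<Longrightarrow> colex_less f (\<sigma> i) (\<sigma> j)"
    and Kf: "\<And>i. Kf i = {\<sigma> j | j. 1 \<le> j \<and> j \<le> i}"
    and T: "T = {i \<in> {1..N - 1}. (\<sigma> i, \<sigma> (i + 1)) \<in> colex_vector_field V K f}"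
    and J: "J = {1..N} - T"
  shows "interval_decomposition (filtration_homology {0..N} Kf) =
         interval_decomposition (filtration_homology ({0} \<union> J) Kf) +
         image_mset (\<lambda>i. (i, enat (i + 1))) (mset_set T)"
proof -
  have enumK: "\<sigma> i \<in> K" if "i \<in> {1..N}" for i using bij_betwE[OF enum] that by blast
  \<comment> \<open>With j < i, \<open>colex\<close> would put the coface before its face. Arguing
    by contraposition avoids proving that the colex order is antisymmetric.\<close>
  interpret simplexwise_filtration V K N \<sigma>
  proof
    fix i j assume ij: "i \<in> {1..N}" "j \<in> {1..N}" "\<sigma> i \<subset> \<sigma> j"
    have \<sigma>: "finite (\<sigma> j)" "\<sigma> j \<subseteq> V" "\<sigma> i \<noteq> {}"
      using K(2) enumK[OF ij(1)] enumK[OF ij(2)] unfolding simplicial_complex_def by blast+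
    have "inj_on f (\<sigma> j)" using bij_betw_imp_inj_on[OF f] \<sigma>(2) by (rule inj_on_subset)
    then have "\<not> colex_less f (\<sigma> j) (\<sigma> i)" using \<sigma> ij(3) by (intro not_colex_less_subset)
    then have "\<not> j < i" using colex[of j i] ij by auto
    moreover have "i \<noteq> j" using ij(3) by auto
    ultimately show "i < j" by simp
  qed fact+
  have KF: "Kf = frame" using Kf unfolding frame_def by (auto simp: fun_eq_iff image_def)
  obtain z q where B: "paired_basis N z q" using paired_basis_exists by blast
  define Pos where "Pos = {i \<in> {1..N}. q i = 0}"
  define lab where "lab i = (i, death q i)" for i
  have q_less: "q k < k" if "k \<in> {1..N}" for k using B that unfolding paired_basis_def by blast
  have death_cases: "death q i = \<infinity> \<or> (\<exists>k\<in>{1..N}. i = q k \<and> death q i = enat k)" if "i \<noteq> 0" for i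
  proof (cases "i \<in> q ` {1..N}")
    case True
    then obtain k where "k \<in> {1..N}" "i = q k" by blast
    then show ?thesis using death_eq[OF B, of k] that by metis
  qed (simp add: death_def)
  have q_Suc: "q (Suc i) = i" if "i \<in> T" for i
  proof (rule paired_with_last_face[OF B])
    have i: "i \<in> {1..N - 1}" and arrow: "(\<sigma> i, \<sigma> (Suc i)) \<in> colex_vector_field V K f"
      using that unfolding T by auto
    show "Suc i \<in> {1..N}" "1 \<le> i" using i by auto
    let ?c = "candidate_vertex V K f (\<sigma> i)"
    have "\<sigma> i \<in> K" "\<sigma> (Suc i) = insert ?c (\<sigma> i)" "?c \<notin> \<sigma> i"
      using arrow unfolding colex_vector_field_def simplices_def by auto
    then show "incidence (\<sigma> i) (\<sigma> (Suc i)) \<noteq> 0"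
      using simplex[of "\<sigma> i"] unfolding incidence_def by auto
  qed
  have T_N: "i \<in> {1..N}" "Suc i \<in> {1..N}" if "i \<in> T" for i using that unfolding T by auto
  have T_death: "death q i = enat (i + 1)" if "i \<in> T" for i
    using death_eq[OF B T_N(2)[OF that]] q_Suc[OF that] T_N(1)[OF that] by simp
  \<comment> \<open>Being the partner of i + 1, the index i belongs to a boundary and hence to a
    cycle.\<close>
  have q_T: "q i = 0" if "i \<in> T" for i
    using paired_basis_cycle[OF order_refl B T_N(2)[OF that]] q_Suc[OF that] T_N(1)[OF that] by simp
  have "T \<subseteq> Pos" using T_N q_T unfolding Pos_def by blast
  have full: "decomposes_into (filtration_homology {0..N} frame) (image_mset lab (mset_set Pos))"
    unfolding lab_def
  proof (rule decomposes_into_filtration_homology[OF B])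
    fix i assume "i \<in> Pos"
    then have i: "i \<in> {1..N}" unfolding Pos_def by auto
    show "(i, death q i) \<in> interval_labels {0..N}"
      using death_cases[of i] i q_less unfolding interval_labels_def by auto
  qed (auto simp: Pos_def)
  have I': "{0} \<union> J \<subseteq> {0..N}" unfolding J by auto
  have reduced: "decomposes_into (filtration_homology ({0} \<union> J) frame) (image_mset lab (mset_set (Pos - T)))"
    unfolding lab_def
  proof (rule decomposes_into_filtration_homology[OF B I'])
    fix i assume "i \<in> Pos - T"
    then have i: "i \<in> {1..N}" "i \<notin> T" unfolding Pos_def by auto
    \<comment> \<open>A right endpoint k in T would have q k = 0, whereas q k = i is
      positive.\<close>
    have "k \<in> J" if "k \<in> {1..N}" "i = q k" for k using q_T[of k] that i(1) unfolding J by auto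
    then show "(i, death q i) \<in> interval_labels ({0} \<union> J)"
      using death_cases[of i] i q_less unfolding interval_labels_def J by fastforce
  next
    fix i j assume "i \<in> {1..N}" "q i = 0" "i \<notin> Pos - T" and j: "j \<in> {0} \<union> J"
    then have i: "i \<in> T" "i \<in> {1..N}" "q i = 0" unfolding Pos_def by auto
    \<comment> \<open>The interval [i, i+1) contains the single index i, which the smaller index set
      omits.\<close>
    have "j \<noteq> i" using i j unfolding J by auto
    moreover have "j \<le> N" using j I' by auto
    ultimately show "i \<notin> active q j" unfolding active_iff[OF B \<open>j \<le> N\<close> i(2,3)] T_death[OF i(1)] by auto
  qed (auto simp: Pos_def)
  have "finite Pos" unfolding Pos_def by simp
  then have "mset_set Pos = mset_set (Pos - T) + mset_set T"
    using mset_set_Union[of "Pos - T" T] finite_subset[OF \<open>T \<subseteq> Pos\<close>] \<open>T \<subseteq> Pos\<close>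
    by (simp add: Un_absorb2 Diff_Int_distrib2)
  moreover have "image_mset lab (mset_set T) = image_mset (\<lambda>i. (i, enat (i + 1))) (mset_set T)"
  proof (rule image_mset_cong)
    fix i assume "i \<in># mset_set T"
    then have "i \<in> T" by (metis elem_mset_set empty_iff mset_set.infinite set_mset_empty)
    then show "lab i = (i, enat (i + 1))" using T_death unfolding lab_def by simp
  qed
  ultimately show ?thesis
    unfolding KF interval_decomposition_filtration_homology[OF order_refl full]
      interval_decomposition_filtration_homology[OF I' reduced] by simp
qed

end
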